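(* Let $X$ and $Y$ be independent, positive, non-degenerate random variables. Let $r\in\mathbb{R}$ be a fixed number; in the case $r<1$ assume $\mathbb{E}X^{r-1}<\infty$. Let $$U=\frac{1+\frac{1}{X+Y}}{1+\frac{1}{X}},\qquad V=X+Y.$$ Suppose that for $s\in\{r,r+1\}$ and some constants $\alpha_s\in\mathbb{R}$ $$\mathbb{E}(U^s\mid V)=\alpha_s\,\mathbb{E}(U^{s-1}\mid V).$$ Then $\alpha_r,\alpha_{r+1}\in(0,1)$, $\dfrac{\alpha_r(1-\alpha_{r+1})}{\alpha_{r+1}}>r-1$, and there exists a constant $c_r>0$ such that $$X\sim\mathcal{K}\left(\frac{\alpha_r(1-\alpha_{r+1})}{\alpha_{r+1}}-r+1,\;\frac{(1-\alpha_r)(1-\alpha_{r+1})}{\alpha_{r+1}},\;c_r\right)\qquad\text{and}\qquad Y\sim\mathcal{G}\left(\frac{(1-\alpha_r)(1-\alpha_{r+1})}{\alpha_{r+1}},\;c_r\right).$$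
   Context: For $a>0$, $b\in\mathbb{R}$, $c>0$, the Kummer distribution $\mathcal{K}(a,b,c)$ is the probability distribution on $(0,\infty)$ with density proportional to $\dfrac{x^{a-1}e^{-cx}}{(1+x)^{a+b}}\,I_{(0,\infty)}(x)$. For $b>0$, $c>0$, the gamma distribution $\mathcal{G}(b,c)$ is the probability distribution on $(0,\infty)$ with density proportional to $y^{b-1}e^{-cy}I_{(0,\infty)}(y)$. A random variable is non-degenerate if it is not almost surely constant. Equalities between conditional expectations are understood almost surely.
   Formalization: The denominator α_{r+1} is corrected to α_{r+1} − α_r in the inequality and in all Kummer and gamma parameters; as printed the claim fails, e.g. for r = 1, X ~ K(1,1,c), Y ~ G(1,c), where α_1 = 1/2, α_2 = 2/3. *)

theory Defs
  imports "HOL-Probability.Probability"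
begin

(* Junk value: if w is not integrable, the integral is 0 and the result is the
   zero function, which is not the density of any random variable. *)
definition normalized_density :: "(real \<Rightarrow> real) \<Rightarrow> real \<Rightarrow> real" where
  "normalized_density w x = w x / (\<integral>t. w t \<partial>lborel)"

definition kummer_density :: "real \<Rightarrow> real \<Rightarrow> real \<Rightarrow> real \<Rightarrow> real" where
  "kummer_density a b c =
     normalized_density
       (\<lambda>x. x powr (a - 1) * exp (- c * x) / (1 + x) powr (a + b) * indicator {0<..} x)"

definition gamma_density :: "real \<Rightarrow> real \<Rightarrow> real \<Rightarrow> real" where
  "gamma_density b c =
     normalized_density (\<lambda>y. y powr (b - 1) * exp (- c * y) * indicator {0<..} y)"

definition nondegenerate :: "'a measure \<Rightarrow> ('a \<Rightarrow> real) \<Rightarrow> bool" where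
  "nondegenerate M X \<longleftrightarrow> \<not> (\<exists>k. AE \<omega> in M. X \<omega> = k)"

(* Conditional expectation of Z given the sigma-algebra generated by V. *)
definition cond_exp_given :: "'a measure \<Rightarrow> ('a \<Rightarrow> real) \<Rightarrow> ('a \<Rightarrow> real) \<Rightarrow> 'a \<Rightarrow> real" where
  "cond_exp_given M Z V = real_cond_exp M (vimage_algebra (space M) V borel) Z"

(* Origin of the parameters in the characterization theorem. If X has the Kummer
   density with parameters a, b, c and Y is independent of X with the gamma density
   with parameters b, c, then U is Beta(a, b) distributed and independent of V, so
   the regression constants are alpha_s = (a + s - 1) / (a + b + s - 1). Solving for
   s = r and s = r + 1 gives
     a + r - 1 = alpha_r (1 - alpha_{r+1}) / (alpha_{r+1} - alpha_r),
     b = (1 - alpha_r) (1 - alpha_{r+1}) / (alpha_{r+1} - alpha_r).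
   With the denominator alpha_{r+1} in place of alpha_{r+1} - alpha_r the result
   would be false: take a = b = r = 1, so that alpha_1 = 1/2, alpha_2 = 2/3
   and (1 - alpha_1) (1 - alpha_2) / alpha_2 = 1/4, which is not b. *)

end

theory Submission
  imports Defs
begin

text \<open>
  Write W = X / (1 + X), so that U = W (1 + V) / V. Testing the regression conditions against
  V exp (- t V) (V / (1 + V)) powr (s - 1) and factorizing by independence turns them into relations
  between f(t) = E[W powr (r - 1) exp (- t X)], g(t) = E[W powr r exp (- t X)], their derivatives, and
  m(t) = E[exp (- t Y)]. Eliminating X from these relations shows that n = - m / m' has constant
  derivative \<beta> / (1 - \<beta>) - \<alpha> / (1 - \<alpha>), where \<alpha> and \<beta> are the two regression constants. This
  derivative is positive by the strict Cauchy-Schwarz inequality, so n(t) = (t + c) / b.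

  Both Y and the measure with density W powr (r - 1) with respect to the law of X then have a Laplace
  transform satisfying an equation of the form (t + c) L(x \<mu>) = L((\<theta> - \<kappa> x / (1 + x)) \<mu>).
  Undoing the factor t by an integration, uniqueness of Laplace transforms
  gives that x \<mu> has a density q with q(x) equal to the integral of
  \<psi>(y) = \<theta> - \<kappa> y / (1 + y) - c y against \<mu> over (0, x]. Hence q' = (\<psi>(x) / x) q, and q is explicit.
\<close>

section \<open>Laplace transforms\<close>

text \<open>Apart from X powr (r - 1) for r < 1, no moments of X or Y are assumed, and negative
  powers of W blow up near X = 0. The weight exp (- t V) and the integrability of W powr (r - 1)
  keep every expectation finite. The elimination rests on W (1 + X) = X: transforms with consecutive
  powers of W are linked by linear relations with their derivatives, so the conditions at s = r and
  s = r + 1 close up. Y enters these conditions only through n, which both share. This is why the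
  same c occurs in both laws: it is the integration constant of n, divided by its slope 1 / b. The
  first condition then reads (1 - \<alpha>) n f' = g - \<alpha> f, which gives \<kappa> = b / (1 -
  \<alpha>) and \<theta> = \<alpha> \<kappa> for the law of X. Positivity of n yields only c \<ge>
  0. The strict inequalities c > 0 and \<theta> > r - 1 become visible at the very end, from the
  finite total mass of the explicit densities.\<close>

lemma mult_exp_minus_le:
  fixes z t :: real
  assumes "t > 0" "z \<ge> 0"
  shows "z * exp (- t * z) \<le> 2 / t * exp (- (t / 2) * z)"
proof -
  have "t / 2 * z \<le> exp (t / 2 * z)"
    using exp_ge_add_one_self[of "t / 2 * z"] by linarith
  hence "t / 2 * z * exp (- t * z) \<le> exp (t / 2 * z) * exp (- t * z)"
    by (intro mult_right_mono) auto
  also have "\<dots> = exp (- (t / 2) * z)" by (simp flip: exp_add add: algebra_simps)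
  finally show ?thesis using assms by (simp add: field_simps)
qed

text \<open>The increments in a difference quotient take both signs, so the majorant has to be
  insensitive to the sign of \<open>u\<close>.\<close>

lemma abs_exp_minus_one_le: "\<bar>exp u - 1\<bar> \<le> \<bar>u\<bar> * exp \<bar>u\<bar>" for u :: real
proof (cases "u \<ge> 0")
  case True
  have "(1 - u) * exp u \<le> exp (- u) * exp u"
    using exp_ge_add_one_self[of "- u"] by (intro mult_right_mono) auto
  with True show ?thesis by (simp add: exp_minus algebra_simps)
next
  case False
  have "1 - exp u \<le> - u * 1" using exp_ge_add_one_self[of u] by linarith
  also have "\<dots> \<le> - u * exp (- u)" using False by (intro mult_left_mono) auto
  finally show ?thesis using False by simp
qed

text \<open>Half of the exponent pays for the factor \<open>Z\<close>: the product is dominated by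
  the hypothesis at t / 2. The conclusion has the same shape as the hypothesis, so the lemma can be
  iterated to reach second derivatives.\<close>

lemma laplace_integrable_mult:
  fixes h Z :: "'a \<Rightarrow> real"
  assumes [measurable]: "h \<in> borel_measurable M" "Z \<in> borel_measurable M"
    and Z: "AE \<omega> in M. Z \<omega> \<ge> 0"
    and int: "\<And>s. s > 0 \<Longrightarrow> integrable M (\<lambda>\<omega>. h \<omega> * exp (- s * Z \<omega>))"
    and t: "t > 0"
  shows "integrable M (\<lambda>\<omega>. h \<omega> * Z \<omega> * exp (- t * Z \<omega>))"
proof (rule Bochner_Integration.integrable_bound)
  show "integrable M (\<lambda>\<omega>. 2 / t * (h \<omega> * exp (- (t / 2) * Z \<omega>)))"
    using int[of "t / 2"] t by (intro integrable_mult_right) auto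
  show "AE \<omega> in M. norm (h \<omega> * Z \<omega> * exp (- t * Z \<omega>)) \<le> norm (2 / t * (h \<omega> * exp (- (t / 2) * Z \<omega>)))"
    using Z
  proof eventually_elim
    case (elim \<omega>)
    show ?case
      using mult_left_mono[OF mult_exp_minus_le[OF t elim], of "\<bar>h \<omega>\<bar>"] elim t
      by (simp add: abs_mult mult_ac)
  qed
qed measurable

lemma laplace_has_derivative:
  fixes h Z :: "'a \<Rightarrow> real"
  assumes [measurable]: "h \<in> borel_measurable M" "Z \<in> borel_measurable M"
    and Z: "AE \<omega> in M. Z \<omega> \<ge> 0"
    and int: "\<And>s. s > 0 \<Longrightarrow> integrable M (\<lambda>\<omega>. h \<omega> * exp (- s * Z \<omega>))"
    and t: "t > 0"
  shows "((\<lambda>t. \<integral>\<omega>. h \<omega> * exp (- t * Z \<omega>) \<partial>M) has_real_derivative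
           - (\<integral>\<omega>. h \<omega> * Z \<omega> * exp (- t * Z \<omega>) \<partial>M)) (at t)"
proof -
  let ?F = "\<lambda>t. \<integral>\<omega>. h \<omega> * exp (- t * Z \<omega>) \<partial>M"
  \<comment> \<open>Increments below t / 2 always leave the decay exp (- (t / 2) Z), hence a
    majorant independent of the increment. Since this interval is a neighbourhood of 0, the
    restriction does not affect the limit.\<close>
  let ?S = "{- t / 2<..<t / 2}"
  have "((\<lambda>d. (?F (t + d) - ?F t) / d) \<longlongrightarrow> - (\<integral>\<omega>. h \<omega> * Z \<omega> * exp (- t * Z \<omega>) \<partial>M)) (at 0 within ?S)"
    unfolding tendsto_at_iff_sequentially comp_def
  proof (intro allI impI)
    fix d :: "nat \<Rightarrow> real"
    assume mem: "\<forall>i. d i \<in> ?S - {0}" and lim: "d \<longlonglongrightarrow> 0"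
    have dS: "\<bar>d i\<bar> < t / 2" and d0: "d i \<noteq> 0" for i
      using mem[rule_format, of i] by (auto simp: abs_less_iff)
    have "(\<lambda>i. \<integral>\<omega>. h \<omega> * ((exp (- (t + d i) * Z \<omega>) - exp (- t * Z \<omega>)) / d i) \<partial>M)
            \<longlonglongrightarrow> (\<integral>\<omega>. h \<omega> * (- Z \<omega> * exp (- t * Z \<omega>)) \<partial>M)"
    proof (rule integral_dominated_convergence)
      show "integrable M (\<lambda>\<omega>. \<bar>h \<omega> * Z \<omega> * exp (- (t / 2) * Z \<omega>)\<bar>)"
        using laplace_integrable_mult[of h M Z "t / 2"] assms by auto
      show "AE \<omega> in M. (\<lambda>i. h \<omega> * ((exp (- (t + d i) * Z \<omega>) - exp (- t * Z \<omega>)) / d i))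
              \<longlonglongrightarrow> h \<omega> * (- Z \<omega> * exp (- t * Z \<omega>))"
      proof (intro AE_I2 tendsto_mult tendsto_const)
        fix \<omega>
        have "((\<lambda>t. exp (- t * Z \<omega>)) has_real_derivative - Z \<omega> * exp (- t * Z \<omega>)) (at t)"
          by (auto intro!: derivative_eq_intros)
        hence "((\<lambda>d. (exp (- (t + d) * Z \<omega>) - exp (- t * Z \<omega>)) / d)
                 \<longlongrightarrow> - Z \<omega> * exp (- t * Z \<omega>)) (at 0)"
          by (simp only: DERIV_def)
        moreover have "filterlim d (at 0) sequentially"
          using lim d0 by (simp add: filterlim_at)
        ultimately show "(\<lambda>i. (exp (- (t + d i) * Z \<omega>) - exp (- t * Z \<omega>)) / d i)
              \<longlonglongrightarrow> - Z \<omega> * exp (- t * Z \<omega>)"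
          by (rule filterlim_compose)
      qed
      show "AE \<omega> in M. norm (h \<omega> * ((exp (- (t + d i) * Z \<omega>) - exp (- t * Z \<omega>)) / d i))
              \<le> \<bar>h \<omega> * Z \<omega> * exp (- (t / 2) * Z \<omega>)\<bar>" for i
        using Z
      proof eventually_elim
        case (elim \<omega>)
        let ?z = "Z \<omega>"
        have "exp (- (t + d i) * ?z) - exp (- t * ?z) = exp (- t * ?z) * (exp (- d i * ?z) - 1)"
          by (simp add: algebra_simps exp_add exp_diff exp_minus field_simps)
        hence "\<bar>exp (- (t + d i) * ?z) - exp (- t * ?z)\<bar> = exp (- t * ?z) * \<bar>exp (- d i * ?z) - 1\<bar>"
          by (simp add: abs_mult)
        also have "\<dots> \<le> exp (- t * ?z) * (\<bar>- d i * ?z\<bar> * exp \<bar>- d i * ?z\<bar>)"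
          by (intro mult_left_mono abs_exp_minus_one_le) auto
        also have "\<dots> = \<bar>d i\<bar> * ?z * exp ((\<bar>d i\<bar> - t) * ?z)"
          using elim by (simp add: abs_mult algebra_simps exp_diff exp_minus field_simps)
        also have "\<dots> \<le> \<bar>d i\<bar> * ?z * exp (- (t / 2) * ?z)"
          using dS[of i] elim by (intro mult_left_mono iffD2[OF exp_le_cancel_iff] mult_right_mono) auto
        finally have "\<bar>exp (- (t + d i) * ?z) - exp (- t * ?z)\<bar> / \<bar>d i\<bar> \<le> ?z * exp (- (t / 2) * ?z)"
          using d0[of i] by (simp add: field_simps)
        from mult_left_mono[OF this, of "\<bar>h \<omega>\<bar>"] show ?case
          using elim by (simp add: abs_mult mult_ac)
      qed
    qed measurable
    also have "(\<lambda>i. \<integral>\<omega>. h \<omega> * ((exp (- (t + d i) * Z \<omega>) - exp (- t * Z \<omega>)) / d i) \<partial>M)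
                 = (\<lambda>i. (?F (t + d i) - ?F t) / d i)"
    proof
      fix i
      have "t + d i > 0" using dS[of i] t by (auto simp: abs_less_iff)
      have "(\<integral>\<omega>. h \<omega> * ((exp (- (t + d i) * Z \<omega>) - exp (- t * Z \<omega>)) / d i) \<partial>M)
          = (\<integral>\<omega>. (h \<omega> * exp (- (t + d i) * Z \<omega>) - h \<omega> * exp (- t * Z \<omega>)) / d i \<partial>M)"
        by (intro Bochner_Integration.integral_cong) (auto simp: right_diff_distrib)
      also have "\<dots> = (?F (t + d i) - ?F t) / d i"
        using int[OF t] int[OF \<open>t + d i > 0\<close>] by simp
      finally show "(\<integral>\<omega>. h \<omega> * ((exp (- (t + d i) * Z \<omega>) - exp (- t * Z \<omega>)) / d i) \<partial>M) = (?F (t + d i) - ?F t) / d i" .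
    qed
    also have "(\<integral>\<omega>. h \<omega> * (- Z \<omega> * exp (- t * Z \<omega>)) \<partial>M) = - (\<integral>\<omega>. h \<omega> * Z \<omega> * exp (- t * Z \<omega>) \<partial>M)"
      by (subst integral_minus[symmetric]) (simp add: mult.assoc)
    finally show "(\<lambda>i. (?F (t + d i) - ?F t) / d i) \<longlonglongrightarrow> - (\<integral>\<omega>. h \<omega> * Z \<omega> * exp (- t * Z \<omega>) \<partial>M)" .
  qed
  moreover have "at 0 within ?S = at 0"
    using t by (intro at_within_open) auto
  ultimately show ?thesis by (simp only: DERIV_def)
qed

text \<open>The exponentials exp (- n x) are the monomials in z = exp (- x) \<in> [0, 1], so the Weierstrass
  theorem extends the equality of integrals from them to all continuous functions of z.\<close>
lemma laplace_unique_continuous: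
  fixes h k :: "real \<Rightarrow> real" and \<mu> \<nu> :: "real measure" and \<phi> :: "real \<Rightarrow> real"
  assumes [measurable_cong]: "sets \<mu> = sets borel" "sets \<nu> = sets borel"
    and h: "integrable \<mu> h" and k: "integrable \<nu> k"
    and h0: "AE x in \<mu>. x < 0 \<longrightarrow> h x = 0" and k0: "AE x in \<nu>. x < 0 \<longrightarrow> k x = 0"
    and eq: "\<And>n::nat. (\<integral>x. h x * exp (- n * x) \<partial>\<mu>) = (\<integral>x. k x * exp (- n * x) \<partial>\<nu>)"
    and \<phi>: "continuous_on UNIV \<phi>"
  shows "(\<integral>x. h x * \<phi> (exp (- x)) \<partial>\<mu>) = (\<integral>x. k x * \<phi> (exp (- x)) \<partial>\<nu>)"
proof -
  have meas: "\<psi> \<in> borel_measurable borel" if "continuous_on UNIV \<psi>" for \<psi> :: "real \<Rightarrow> real"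
    using that by (rule borel_measurable_continuous_onI)
  have bound: "\<exists>B. \<forall>z\<in>{0..1}. \<bar>\<psi> z\<bar> \<le> B" if "continuous_on UNIV \<psi>" for \<psi> :: "real \<Rightarrow> real"
  proof -
    have "compact (\<psi> ` {0..1})"
      using that by (intro compact_continuous_image continuous_on_subset[OF that]) auto
    thus ?thesis using compact_imp_bounded[THEN bounded_normE] by (metis imageI real_norm_def)
  qed
  \<comment> \<open>The value exp (- x) lies in [0, 1] only for x \<ge> 0. The weight vanishes
    elsewhere, so a bound of the test function on [0, 1] is enough.\<close>
  have le: "norm (h' x * \<psi> (exp (- x))) \<le> norm (B * h' x)"
    if "x < 0 \<longrightarrow> h' x = 0" "\<forall>z\<in>{0..1}. \<bar>\<psi> z\<bar> \<le> B" for h' \<psi> :: "real \<Rightarrow> real" and B x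
  proof (cases "x < 0")
    case False
    hence "\<bar>\<psi> (exp (- x))\<bar> \<le> B" using that(2) by auto
    from mult_left_mono[OF this, of "\<bar>h' x\<bar>"] show ?thesis
      using \<open>\<bar>\<psi> (exp (- x))\<bar> \<le> B\<close> by (simp add: abs_mult mult.commute)
  qed (use that in auto)
  have int: "integrable N (\<lambda>x. h' x * \<psi> (exp (- x)))"
    if [measurable_cong]: "sets N = sets borel" and "integrable N h'" and 0: "AE x in N. x < 0 \<longrightarrow> h' x = 0"
      and c: "continuous_on UNIV \<psi>" for N h' and \<psi> :: "real \<Rightarrow> real"
  proof -
    obtain B where B: "\<forall>z\<in>{0..1}. \<bar>\<psi> z\<bar> \<le> B" using bound[OF c] by blast
    note [measurable] = meas[OF c] borel_measurable_integrable[OF that(2)]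
    show ?thesis
    proof (rule Bochner_Integration.integrable_bound)
      show "integrable N (\<lambda>x. B * h' x)" using that by auto
      show "AE x in N. norm (h' x * \<psi> (exp (- x))) \<le> norm (B * h' x)"
        using 0 by eventually_elim (rule le[OF _ B])
    qed measurable
  qed
  have poly: "(\<integral>x. h x * p (exp (- x)) \<partial>\<mu>) = (\<integral>x. k x * p (exp (- x)) \<partial>\<nu>)"
    and poly_cont: "continuous_on UNIV p"
    if p: "real_polynomial_function p" for p
  proof -
    obtain a n where pa: "p = (\<lambda>x. \<Sum>i\<le>n. a i * x ^ i)"
      using p real_polynomial_function_iff_sum by metis
    show "continuous_on UNIV p" unfolding pa by (intro continuous_intros)
    have "(\<integral>x. h' x * p (exp (- x)) \<partial>N) = (\<Sum>i\<le>n. a i * (\<integral>x. h' x * exp (- real i * x) \<partial>N))"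
      if "sets N = sets borel" "integrable N h'" "AE x in N. x < 0 \<longrightarrow> h' x = 0" for N and h' :: "real \<Rightarrow> real"
    proof -
      have "(\<lambda>x::real. h' x * p (exp (- x))) = (\<lambda>x. \<Sum>i\<le>n. a i * (h' x * exp (- real i * x)))"
        by (simp add: pa sum_distrib_left mult_ac flip: exp_of_nat_mult)
      moreover have "integrable N (\<lambda>x::real. h' x * exp (- real i * x))" for i :: nat
        using int[OF that continuous_on_power[OF continuous_on_id, of _ i]] by (simp flip: exp_of_nat_mult)
      ultimately show ?thesis by simp
    qed
    note * = this
    show "(\<integral>x. h x * p (exp (- x)) \<partial>\<mu>) = (\<integral>x. k x * p (exp (- x)) \<partial>\<nu>)"
      by (subst (1 2) *) (use assms in auto)
  qed
  let ?D = "(\<integral>x. h x * \<phi> (exp (- x)) \<partial>\<mu>) - (\<integral>x. k x * \<phi> (exp (- x)) \<partial>\<nu>)"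
  let ?C = "(\<integral>x. \<bar>h x\<bar> \<partial>\<mu>) + (\<integral>x. \<bar>k x\<bar> \<partial>\<nu>)"
  have D: "\<bar>?D\<bar> \<le> e * ?C" if e: "e > 0" for e
  proof -
    have "continuous_on {0..1} \<phi>" using \<phi> by (rule continuous_on_subset) simp
    then obtain p where p: "real_polynomial_function p" and pe: "\<And>z. z \<in> {0..1} \<Longrightarrow> \<bar>\<phi> z - p z\<bar> < e"
      using Stone_Weierstrass_real_polynomial_function[OF compact_Icc _ e, of 0 1 \<phi>] by metis
    have c: "continuous_on UNIV (\<lambda>z. \<phi> z - p z)"
      using \<phi> poly_cont[OF p] by (intro continuous_intros)
    have pe': "\<forall>z\<in>{0..1}. \<bar>\<phi> z - p z\<bar> \<le> e" using pe by (auto intro: less_imp_le)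
    have est: "\<bar>\<integral>x. h' x * (\<phi> (exp (- x)) - p (exp (- x))) \<partial>N\<bar> \<le> e * (\<integral>x. \<bar>h' x\<bar> \<partial>N)"
      if "sets N = sets borel" "integrable N h'" "AE x in N. x < 0 \<longrightarrow> h' x = 0" for N and h' :: "real \<Rightarrow> real"
    proof -
      have "\<bar>\<integral>x. h' x * (\<phi> (exp (- x)) - p (exp (- x))) \<partial>N\<bar> \<le> (\<integral>x. e * \<bar>h' x\<bar> \<partial>N)"
      proof (rule order_trans[OF integral_abs_bound integral_mono_AE])
        show "integrable N (\<lambda>x. \<bar>h' x * (\<phi> (exp (- x)) - p (exp (- x)))\<bar>)"
          using int[OF that c] by (rule integrable_abs)
        show "integrable N (\<lambda>x. e * \<bar>h' x\<bar>)" using that by auto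
        show "AE x in N. \<bar>h' x * (\<phi> (exp (- x)) - p (exp (- x)))\<bar> \<le> e * \<bar>h' x\<bar>"
          using that(3)
        proof eventually_elim
          case (elim x)
          from le[of x h' "\<lambda>z. \<phi> z - p z" e, OF elim pe'] show ?case using e by (simp add: abs_mult)
        qed
      qed
      thus ?thesis by simp
    qed
    have split: "(\<integral>x. h' x * (\<phi> (exp (- x)) - p (exp (- x))) \<partial>N)
        = (\<integral>x. h' x * \<phi> (exp (- x)) \<partial>N) - (\<integral>x. h' x * p (exp (- x)) \<partial>N)"
      if "sets N = sets borel" "integrable N h'" "AE x in N. x < 0 \<longrightarrow> h' x = 0" for N and h' :: "real \<Rightarrow> real"
      using int[OF that \<phi>] int[OF that poly_cont[OF p]] by (simp add: right_diff_distrib)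
    have "?D = (\<integral>x. h x * (\<phi> (exp (- x)) - p (exp (- x))) \<partial>\<mu>) - (\<integral>x. k x * (\<phi> (exp (- x)) - p (exp (- x))) \<partial>\<nu>)"
      using split[of \<mu> h] split[of \<nu> k] assms poly[OF p] by simp
    also have "\<bar>\<dots>\<bar> \<le> e * (\<integral>x. \<bar>h x\<bar> \<partial>\<mu>) + e * (\<integral>x. \<bar>k x\<bar> \<partial>\<nu>)"
      using est[of \<mu> h] est[of \<nu> k] assms by linarith
    finally show ?thesis by (simp add: distrib_left)
  qed
  have "\<bar>?D\<bar> \<le> e" if "e > 0" for e
  proof -
    have C: "?C \<ge> 0" by simp
    \<comment> \<open>Dividing by \<open>?C + 1\<close> rather than \<open>?C\<close> covers the
      case of two null weights.\<close>
    hence "\<bar>?D\<bar> \<le> e / (?C + 1) * ?C" using that by (intro D divide_pos_pos) linarith+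
    also have "\<dots> \<le> e"
    proof -
      have "e / (x + 1) * x \<le> e" if "x \<ge> 0" for x using that \<open>e > 0\<close> by (simp add: field_simps)
      thus ?thesis using C by blast
    qed
    finally show ?thesis .
  qed
  hence "\<bar>?D\<bar> \<le> 0" by (rule dense_ge)
  thus ?thesis by simp
qed

text \<open>Half-lines are reached from continuous functions by dominated convergence, and Borel
  sets from half-lines by a Dynkin argument. The weights are signed because one of them will be a
  density whose sign is not yet known; the conclusion is therefore about integrals and not about
  measures.\<close>

lemma laplace_unique:
  fixes h k :: "real \<Rightarrow> real" and \<mu> \<nu> :: "real measure"
  assumes [measurable_cong]: "sets \<mu> = sets borel" "sets \<nu> = sets borel"
    and h: "integrable \<mu> h" and k: "integrable \<nu> k"
    and h0: "AE x in \<mu>. x < 0 \<longrightarrow> h x = 0" and k0: "AE x in \<nu>. x < 0 \<longrightarrow> k x = 0"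
    and eq: "\<And>n::nat. (\<integral>x. h x * exp (- n * x) \<partial>\<mu>) = (\<integral>x. k x * exp (- n * x) \<partial>\<nu>)"
    and A: "A \<in> sets borel"
  shows "(\<integral>x. indicator A x * h x \<partial>\<mu>) = (\<integral>x. indicator A x * k x \<partial>\<nu>)"
proof -
  note [measurable] = borel_measurable_integrable[OF h] borel_measurable_integrable[OF k]
  have int: "integrable \<mu> (\<lambda>x. indicator B x * h x)" "integrable \<nu> (\<lambda>x. indicator B x * k x)"
    if [measurable]: "B \<in> sets borel" for B
    using integrable_mult_indicator[OF _ h, of B] integrable_mult_indicator[OF _ k, of B] assms(1,2) by auto
  have ray: "(\<integral>x. indicator {..a} x * h x \<partial>\<mu>) = (\<integral>x. indicator {..a} x * k x \<partial>\<nu>)" for a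
  proof -
    \<comment> \<open>Since z = exp (- x) reverses the order, the half-line x \<le> a is z \<ge> exp
      (- a). The function is a ramp that climbs from 0 to 1 on an interval of length 1 / n just
      below exp (- a).\<close>
    define \<phi> where "\<phi> n z = min 1 (max 0 (1 + real n * (z - exp (- a))))" for n z
    have c: "continuous_on UNIV (\<phi> n)" for n unfolding \<phi>_def by (intro continuous_intros)
    have [measurable]: "\<phi> n \<in> borel_measurable borel" for n
      by (rule borel_measurable_continuous_onI[OF c])
    have pt: "(\<lambda>n. \<phi> n (exp (- x))) \<longlonglongrightarrow> indicator {..a} x" for x
    proof (cases "x \<le> a")
      case True
      hence "\<phi> n (exp (- x)) = 1" for n by (simp add: \<phi>_def)
      thus ?thesis using True by simp
    next
      case False
      hence pos: "exp (- a) - exp (- x) > 0" by simp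
      have "filterlim (\<lambda>n. real n * (exp (- a) - exp (- x))) at_top sequentially"
        by (rule filterlim_at_top_mult_tendsto_pos[OF tendsto_const pos filterlim_real_sequentially])
      hence "eventually (\<lambda>n. real n * (exp (- a) - exp (- x)) \<ge> 1) sequentially"
        by (simp add: filterlim_at_top)
      hence "eventually (\<lambda>n. \<phi> n (exp (- x)) = 0) sequentially"
        by eventually_elim (simp add: \<phi>_def algebra_simps)
      thus ?thesis using False by (simp add: tendsto_eventually)
    qed
    have lim: "(\<lambda>n. \<integral>x. h' x * \<phi> n (exp (- x)) \<partial>N) \<longlonglongrightarrow> (\<integral>x. h' x * indicator {..a} x \<partial>N)"
      if [measurable_cong]: "sets N = sets borel" and "integrable N h'" for N and h' :: "real \<Rightarrow> real"
    proof -
      note [measurable] = borel_measurable_integrable[OF that(2)]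
      show ?thesis
      proof (rule integral_dominated_convergence)
        show "integrable N (\<lambda>x. \<bar>h' x\<bar>)" using that by auto
        show "AE x in N. (\<lambda>n. h' x * \<phi> n (exp (- x))) \<longlonglongrightarrow> h' x * indicator {..a} x"
          by (intro AE_I2 tendsto_mult tendsto_const pt)
        show "AE x in N. norm (h' x * \<phi> n (exp (- x))) \<le> \<bar>h' x\<bar>" for n
          by (intro AE_I2) (auto simp: abs_mult \<phi>_def intro!: mult_left_le)
      qed measurable
    qed
    have "(\<lambda>n. \<integral>x. h x * \<phi> n (exp (- x)) \<partial>\<mu>) = (\<lambda>n. \<integral>x. k x * \<phi> n (exp (- x)) \<partial>\<nu>)"
      using laplace_unique_continuous[OF assms(1-7) c] by blast
    with lim[OF assms(1) h] lim[OF assms(2) k]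
    have "(\<integral>x. h x * indicator {..a} x \<partial>\<mu>) = (\<integral>x. k x * indicator {..a} x \<partial>\<nu>)"
      using LIMSEQ_unique by simp
    thus ?thesis by (simp add: mult.commute)
  qed
  \<comment> \<open>The exponent n = 0 compares the total integrals, which complements
    require.\<close>
  have UNIV: "(\<integral>x. h x \<partial>\<mu>) = (\<integral>x. k x \<partial>\<nu>)" using eq[of 0] by simp
  have sb: "sets borel = sigma_sets UNIV (range (\<lambda>a::real. {..a}))"
    by (subst borel_eq_atMost) (simp add: sets_measure_of)
  have "Int_stable (range (\<lambda>a::real. {..a}))"
    by (auto simp: Int_stable_def)
  moreover have "range (\<lambda>a::real. {..a}) \<subseteq> Pow UNIV" by auto
  ultimately show ?thesis using A[unfolded sb]
  proof (induction rule: sigma_sets_induct_disjoint)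
    case (basic B) thus ?case using ray by auto
  next
    case empty thus ?case by simp
  next
    case (compl B)
    hence B: "B \<in> sets borel" by (simp add: sb)
    have *: "indicator (UNIV - B) x * y = y - indicator B x * y" for x y :: real
      by (auto simp: indicator_def)
    show ?case unfolding * using compl UNIV int[OF B] h k by simp
  next
    case (union B)
    hence B[measurable]: "B i \<in> sets borel" for i by (auto simp: sb)
    have sum: "(\<integral>x. indicator (\<Union>i. B i) x * h' x \<partial>N) = (\<Sum>i. \<integral>x. indicator (B i) x * h' x \<partial>N)"
      if "sets N = sets borel" and "integrable N h'" for N and h' :: "real \<Rightarrow> real"
    proof -
      have "set_integrable N (\<Union>i. B i) h'"
        unfolding set_integrable_def using that by (intro integrable_mult_indicator) auto
      moreover have "B i \<in> sets N" for i using B that by simp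
      moreover have "B i \<inter> B j = {}" if "i \<noteq> j" for i j
        using union(1) that by (auto simp: disjoint_family_on_def)
      ultimately show ?thesis
        using lebesgue_integral_countable_add[of B N h'] by (simp add: set_lebesgue_integral_def)
    qed
    show ?case
      using sum[OF assms(1) h] sum[OF assms(2) k] union by simp
  qed
qed

section \<open>Measures determined by a Laplace transform equation\<close>

lemma integral_exp_minus_Ici:
  fixes t y :: real
  assumes "t > 0"
  shows "integrable lborel (\<lambda>x. indicator {y..} x * exp (- t * x))"
    and "(\<integral>x. indicator {y..} x * exp (- t * x) \<partial>lborel) = exp (- t * y) / t"
proof -
  have "((\<lambda>x. - exp (- t * x) / t) \<longlongrightarrow> 0) at_top"
    using assms by real_asymp
  moreover have "((\<lambda>x. - exp (- t * x) / t) has_real_derivative exp (- t * x)) (at x)" for x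
    using assms by (auto intro!: derivative_eq_intros)
  ultimately have "(\<integral>\<^sup>+x. ennreal (exp (- t * x)) * indicator {y..} x \<partial>lborel) = ennreal (0 - (- exp (- t * y) / t))"
    by (intro nn_integral_FTC_atLeast) auto
  also have "(\<integral>\<^sup>+x. ennreal (exp (- t * x)) * indicator {y..} x \<partial>lborel)
      = (\<integral>\<^sup>+x. ennreal (indicator {y..} x * exp (- t * x)) \<partial>lborel)"
    by (intro nn_integral_cong) (auto simp: indicator_def)
  finally have "has_bochner_integral lborel (\<lambda>x. indicator {y..} x * exp (- t * x)) (exp (- t * y) / t)"
    using assms by (intro has_bochner_integral_nn_integral) auto
  thus "integrable lborel (\<lambda>x. indicator {y..} x * exp (- t * x))"
    and "(\<integral>x. indicator {y..} x * exp (- t * x) \<partial>lborel) = exp (- t * y) / t"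
    by (auto simp: has_bochner_integral_iff)
qed

text \<open>By Fubini, with the condition y \<le> x read as a half-line in x, the inner integral is
  exp (- t y) / t. Thus dividing a transform by t means passing to the cumulative integral. The same
  computation with the absolute value of \<psi> justifies the exchange.\<close>

lemma laplace_cumulative:
  fixes \<mu> :: "real measure" and \<psi> :: "real \<Rightarrow> real"
  assumes "finite_measure \<mu>" and [measurable_cong]: "sets \<mu> = sets borel"
    and [measurable]: "\<psi> \<in> borel_measurable borel"
    and t: "t > 0" and int: "integrable \<mu> (\<lambda>y. \<psi> y * exp (- t * y))"
  defines "q \<equiv> \<lambda>x. \<integral>y. indicator {..x} y * \<psi> y \<partial>\<mu>"
  shows "integrable lborel (\<lambda>x. q x * exp (- t * x))"
    and "(\<integral>x. q x * exp (- t * x) \<partial>lborel) = (\<integral>y. \<psi> y * exp (- t * y) \<partial>\<mu>) / t"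
proof -
  interpret \<mu>: finite_measure \<mu> by fact
  interpret pair_sigma_finite \<mu> lborel ..
  let ?F = "\<lambda>y x. \<psi> y * (indicator {y..} x * exp (- t * x))"
  have eq: "?F y x = (indicator {..x} y * \<psi> y) * exp (- t * x)" for x y
    by (auto simp: indicator_def)
  have [measurable]: "case_prod ?F \<in> borel_measurable (\<mu> \<Otimes>\<^sub>M lborel)"
  proof -
    have "case_prod ?F = (\<lambda>(y, x). if y \<le> x then \<psi> y * exp (- t * x) else 0)"
      by (auto simp: indicator_def fun_eq_iff)
    also have "\<dots> \<in> borel_measurable (\<mu> \<Otimes>\<^sub>M lborel)" by measurable
    finally show ?thesis .
  qed
  have F: "integrable (\<mu> \<Otimes>\<^sub>M lborel) (case_prod ?F)"
  proof (rule Fubini_integrable)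
    have "(\<integral>x. norm (?F y x) \<partial>lborel) = \<bar>\<psi> y * exp (- t * y)\<bar> / t" for y
    proof -
      have "(\<integral>x. norm (?F y x) \<partial>lborel) = (\<integral>x. \<bar>\<psi> y\<bar> * (indicator {y..} x * exp (- t * x)) \<partial>lborel)"
        by (simp add: abs_mult)
      also have "\<dots> = \<bar>\<psi> y\<bar> * (exp (- t * y) / t)"
        by (subst integral_mult_right_zero) (simp only: integral_exp_minus_Ici[OF t])
      finally show ?thesis by (simp add: abs_mult)
    qed
    thus "integrable \<mu> (\<lambda>y. \<integral>x. norm (case (y, x) of (y, x) \<Rightarrow> ?F y x) \<partial>lborel)"
      using int by simp
    show "AE y in \<mu>. integrable lborel (\<lambda>x. case (y, x) of (y, x) \<Rightarrow> ?F y x)"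
      using integral_exp_minus_Ici[OF t] by (intro AE_I2) (simp add: integrable_mult_right del: mult_minus_left)
  qed measurable
  have q: "(\<lambda>x. \<integral>y. ?F y x \<partial>\<mu>) = (\<lambda>x. q x * exp (- t * x))"
    unfolding eq q_def by simp
  show "integrable lborel (\<lambda>x. q x * exp (- t * x))"
    using integrable_snd[OF F] by (simp only: q)
  have "(\<integral>x. q x * exp (- t * x) \<partial>lborel) = (\<integral>y. \<integral>x. ?F y x \<partial>lborel \<partial>\<mu>)"
    using Fubini_integral[OF F] by (simp only: q)
  also have "\<dots> = (\<integral>y. \<psi> y * exp (- t * y) / t \<partial>\<mu>)"
    by (subst integral_mult_right_zero) (simp only: integral_exp_minus_Ici[OF t] times_divide_eq_right)
  finally show "(\<integral>x. q x * exp (- t * x) \<partial>lborel) = (\<integral>y. \<psi> y * exp (- t * y) \<partial>\<mu>) / t" by simp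
qed

text \<open>The integral equation supplies its own regularity: an integral is continuous, so the
  integrand is continuous, so \<open>q\<close> is differentiable with q' = \<phi> q, and q / K has
  derivative 0. Everything stays away from 0, where \<phi> may be singular.\<close>

lemma linear_integral_equation_solution:
  fixes q \<phi> K :: "real \<Rightarrow> real"
  assumes \<phi>: "continuous_on {0<..} \<phi>"
    and K: "\<And>x. x > 0 \<Longrightarrow> K x > 0"
    and K': "\<And>x. x > 0 \<Longrightarrow> (K has_real_derivative \<phi> x * K x) (at x)"
    and int: "\<And>a b. 0 < a \<Longrightarrow> a \<le> b \<Longrightarrow> set_integrable lborel {a..b} (\<lambda>x. \<phi> x * q x)"
    and q: "\<And>a b. 0 < a \<Longrightarrow> a \<le> b \<Longrightarrow> q b - q a = (LINT x:{a..b}|lborel. \<phi> x * q x)"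
  shows "\<exists>C. \<forall>x>0. q x = C * K x"
proof -
  have q_eq: "q x = q a + integral {a..x} (\<lambda>x. \<phi> x * q x)" if "0 < a" "a \<le> x" for a x
    using q[OF that] set_borel_integral_eq_integral(2)[OF int[OF that]] by simp
  have cont: "continuous_on {a..b} q" if "0 < a" "a \<le> b" for a b
  proof -
    have "continuous_on {a..b} (\<lambda>x. q a + integral {a..x} (\<lambda>x. \<phi> x * q x))"
      using indefinite_integral_continuous_1[OF set_borel_integral_eq_integral(1)[OF int[OF that]]]
      by (intro continuous_intros)
    thus ?thesis by (rule continuous_on_eq) (simp add: q_eq[OF that(1), symmetric])
  qed
  have q': "(q has_real_derivative \<phi> x * q x) (at x)" if "x > 0" for x
  proof -
    \<comment> \<open>Any compact subinterval of the positive half-line with x in its interior would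
      do; it turns the one-sided derivative of the integral into a two-sided one.\<close>
    let ?a = "x / 2" and ?b = "2 * x"
    have ab: "0 < ?a" "?a \<le> ?b" using that by auto
    have "continuous_on {?a..?b} (\<lambda>x. \<phi> x * q x)"
      using ab by (intro continuous_on_mult cont continuous_on_subset[OF \<phi>]) auto
    from integral_has_real_derivative[OF this, of x] that
    have "((\<lambda>u. q ?a + integral {?a..u} (\<lambda>x. \<phi> x * q x)) has_real_derivative \<phi> x * q x) (at x within {?a..?b})"
      by (auto intro!: derivative_eq_intros)
    hence "(q has_real_derivative \<phi> x * q x) (at x within {?a..?b})"
      by (rule has_field_derivative_transform_within[where d = 1])
        (use that in \<open>auto simp: q_eq[OF ab(1), symmetric]\<close>)
    moreover have "at x within {?a..?b} = at x"
      using that by (intro at_within_interior) simp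
    ultimately show ?thesis by simp
  qed
  have "\<exists>C. \<forall>x\<in>{0<..}. q x / K x = C"
  proof (rule has_field_derivative_zero_constant)
    fix x :: real assume "x \<in> {0<..}"
    hence x: "x > 0" by simp
    have "((\<lambda>x. q x / K x) has_real_derivative 0) (at x)"
      using K[OF x] by (auto intro!: derivative_eq_intros q'[OF x] K'[OF x])
    thus "((\<lambda>x. q x / K x) has_real_derivative 0) (at x within {0<..})"
      by (rule has_field_derivative_at_within)
  qed simp
  then obtain C where "q x / K x = C" if "x > 0" for x by auto
  hence "q x = C * K x" if "x > 0" for x
    using K[OF that] that by (metis less_irrefl nonzero_divide_eq_eq)
  thus ?thesis by blast
qed

text \<open>The equation closes on itself: once x \<mu> is known to have density \<open>q\<close>,
  integration against \<mu> is integration against q(x) / x, so the formula defining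
  \<open>q\<close> becomes a linear equation for \<open>q\<close>. The function \<open>K\<close> is
  a solution supplied in advance.\<close>

lemma density_of_laplace_equation:
  fixes \<mu> :: "real measure" and \<psi> K :: "real \<Rightarrow> real"
  assumes "finite_measure \<mu>" and sets[measurable_cong]: "sets \<mu> = sets borel"
    and pos: "AE x in \<mu>. x > 0"
    and \<psi>[measurable]: "\<psi> \<in> borel_measurable borel" and cont: "continuous_on {0<..} \<psi>"
    and int: "\<And>t. t > 0 \<Longrightarrow> integrable \<mu> (\<lambda>x. \<psi> x * exp (- t * x))"
    and eq: "\<And>t. t > 0 \<Longrightarrow> t * (\<integral>x. x * exp (- t * x) \<partial>\<mu>) = (\<integral>x. \<psi> x * exp (- t * x) \<partial>\<mu>)"
    and K: "\<And>x. x > 0 \<Longrightarrow> K x > 0"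
    and K': "\<And>x. x > 0 \<Longrightarrow> (K has_real_derivative \<psi> x / x * K x) (at x)"
  shows "\<exists>C\<ge>0. \<mu> = density lborel (\<lambda>x. ennreal (C * (K x / x) * indicator {0<..} x))"
proof -
  interpret \<mu>: finite_measure \<mu> by fact
  define q where "q x = (\<integral>y. indicator {..x} y * \<psi> y \<partial>\<mu>)" for x
  have q_int: "integrable lborel (\<lambda>x. q x * exp (- t * x))"
    and q_eq: "(\<integral>x. q x * exp (- t * x) \<partial>lborel) = (\<integral>x. x * exp (- t * x) \<partial>\<mu>)" if "t > 0" for t
    using laplace_cumulative[OF assms(1) sets \<psi> that int[OF that], folded q_def] eq[OF that, symmetric] that
    by simp_all
  \<comment> \<open>Measurability of \<open>q\<close> is recovered from the integrability of its
    product with exp (- x).\<close>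
  have [measurable]: "q \<in> borel_measurable borel"
  proof -
    have [measurable]: "(\<lambda>x. q x * exp (- 1 * x)) \<in> borel_measurable borel"
      using borel_measurable_integrable[OF q_int[OF zero_less_one]] by simp
    have "(\<lambda>x. (q x * exp (- 1 * x)) * exp x) \<in> borel_measurable borel" by measurable
    also have "(\<lambda>x. (q x * exp (- 1 * x)) * exp x) = q" by (simp add: mult.assoc flip: exp_add)
    finally show ?thesis .
  qed
  have q0: "q x = 0" if "x \<le> 0" for x
  proof -
    have "q x = (\<integral>y. 0 \<partial>\<mu>)" unfolding q_def
      using pos that by (intro integral_cong_AE) (auto simp: indicator_def)
    thus ?thesis by simp
  qed
  \<comment> \<open>Finite total mass is not known for x \<mu> or for \<open>q\<close>. The tilt by
    exp (- x) makes both integrable and moves the exponents n to n + 1 > 0, where the transforms are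
    known to agree.\<close>
  let ?h = "\<lambda>x. x * exp (- x)" and ?k = "\<lambda>x. q x * exp (- x)"
  have h_int: "integrable \<mu> ?h"
  proof -
    have "integrable \<mu> (\<lambda>x. 1 * exp (- s * x))" if "s > 0" for s
      using pos that by (intro \<mu>.integrable_const_bound[where B = 1]) (auto elim!: eventually_mono)
    hence "integrable \<mu> (\<lambda>x. 1 * x * exp (- 1 * x))"
      using pos by (intro laplace_integrable_mult) (auto elim!: eventually_mono)
    thus ?thesis by simp
  qed
  have k_int: "integrable lborel ?k" using q_int[of 1] by simp
  have Borel: "(\<integral>x. indicator A x * ?h x \<partial>\<mu>) = (\<integral>x. indicator A x * ?k x \<partial>lborel)"
    if "A \<in> sets borel" for A
  proof (rule laplace_unique[OF sets sets_lborel h_int k_int _ _ _ that])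
    show "AE x in \<mu>. x < 0 \<longrightarrow> ?h x = 0" using pos by eventually_elim auto
    show "AE x in lborel. x < 0 \<longrightarrow> ?k x = 0" using q0 by auto
    fix n :: nat
    have "exp (- x) * exp (- real n * x) = exp (- (real n + 1) * x)" for x
      by (simp add: algebra_simps flip: exp_add)
    moreover have "0 < real n + 1" by simp
    ultimately show "(\<integral>x. ?h x * exp (- real n * x) \<partial>\<mu>) = (\<integral>x. ?k x * exp (- real n * x) \<partial>lborel)"
      by (simp only: mult.assoc q_eq)
  qed
  have q_nonneg: "AE x in lborel. 0 \<le> q x"
  proof -
    let ?A = "{x. q x < 0}"
    \<comment> \<open>the integral of ?k over ?A is at most 0, but equals that of the nonnegative ?h\<close>
    have [measurable]: "?A \<in> sets borel" by measurable
    have int: "integrable lborel (\<lambda>x. - (indicator ?A x * ?k x))"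
      using integrable_mult_indicator[OF _ k_int, of ?A] by simp
    have nonneg: "AE x in lborel. 0 \<le> - (indicator ?A x * ?k x)"
      by (intro AE_I2) (auto simp: indicator_def mult_nonpos_nonneg)
    have "0 \<le> (\<integral>x. indicator ?A x * ?h x \<partial>\<mu>)"
      using pos by (intro integral_nonneg_AE) (auto elim!: eventually_mono simp: indicator_def)
    hence "(\<integral>x. - (indicator ?A x * ?k x) \<partial>lborel) \<le> 0"
      using Borel[of ?A] by simp
    moreover have "0 \<le> (\<integral>x. - (indicator ?A x * ?k x) \<partial>lborel)"
      using nonneg by (rule integral_nonneg_AE)
    ultimately have "(\<integral>x. - (indicator ?A x * ?k x) \<partial>lborel) = 0" by simp
    hence "AE x in lborel. - (indicator ?A x * ?k x) = 0"
      using integral_nonneg_eq_0_iff_AE[OF int nonneg] by simp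
    thus ?thesis by eventually_elim (auto simp: indicator_def split: if_splits)
  qed
  have "density \<mu> (\<lambda>x. ennreal (?h x)) = density lborel (\<lambda>x. ennreal (?k x))"
  proof (rule measure_eqI)
    fix A assume "A \<in> sets (density \<mu> (\<lambda>x. ennreal (?h x)))"
    hence A[measurable]: "A \<in> sets borel" by (simp add: sets)
    have *: "(\<integral>\<^sup>+x. ennreal (f x) * indicator A x \<partial>N) = ennreal (\<integral>x. indicator A x * f x \<partial>N)"
      if [measurable_cong]: "sets N = sets borel" and f: "integrable N f" and nonneg: "AE x in N. 0 \<le> f x"
      for N and f :: "real \<Rightarrow> real"
    proof -
      have "(\<integral>\<^sup>+x. ennreal (f x) * indicator A x \<partial>N) = (\<integral>\<^sup>+x. ennreal (indicator A x * f x) \<partial>N)"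
        by (intro nn_integral_cong) (auto simp: indicator_def)
      also have "\<dots> = ennreal (\<integral>x. indicator A x * f x \<partial>N)"
        using integrable_mult_indicator[OF _ f, of A] nonneg that(1)
        by (intro nn_integral_eq_integral) (auto elim!: eventually_mono)
      finally show ?thesis .
    qed
    have "AE x in \<mu>. 0 \<le> ?h x" "AE x in lborel. 0 \<le> ?k x"
      using pos q_nonneg by (auto elim!: eventually_mono)
    thus "emeasure (density \<mu> (\<lambda>x. ennreal (?h x))) A = emeasure (density lborel (\<lambda>x. ennreal (?k x))) A"
      using *[OF sets h_int] *[OF sets_lborel k_int] Borel[OF A]
      by (simp add: emeasure_density)
  qed (simp add: sets)
  \<comment> \<open>Multiplying by exp x / x on the positive half-line removes both the tilt and the
    factor x, which recovers \<mu> itself.\<close>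
  hence "density (density \<mu> (\<lambda>x. ennreal (?h x))) (\<lambda>x. ennreal (exp x / x * indicator {0<..} x))
       = density (density lborel (\<lambda>x. ennreal (?k x))) (\<lambda>x. ennreal (exp x / x * indicator {0<..} x))"
    by simp
  hence "density \<mu> (\<lambda>x. ennreal (?h x) * ennreal (exp x / x * indicator {0<..} x))
       = density lborel (\<lambda>x. ennreal (?k x) * ennreal (exp x / x * indicator {0<..} x))"
    by (simp add: density_density_eq)
  moreover have "density \<mu> (\<lambda>x. ennreal (?h x) * ennreal (exp x / x * indicator {0<..} x)) = density \<mu> (\<lambda>_. 1)"
    using pos by (intro density_cong) (auto elim!: eventually_mono simp: exp_minus simp flip: ennreal_mult'')
  moreover have "density lborel (\<lambda>x. ennreal (?k x) * ennreal (exp x / x * indicator {0<..} x))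
      = density lborel (\<lambda>x. ennreal (q x / x * indicator {0<..} x))"
    by (intro density_cong) (auto simp: exp_minus field_simps indicator_def simp flip: ennreal_mult'')
  ultimately have \<mu>_q: "\<mu> = density lborel (\<lambda>x. ennreal (q x / x * indicator {0<..} x))"
    by (simp add: density_1)
  have p_nonneg: "AE x in lborel. 0 \<le> q x / x * indicator {0<..} x"
    using q_nonneg by eventually_elim (auto simp: indicator_def)
  \<comment> \<open>Integrability of \<psi> is given only under an exponential weight, but on a set
    bounded above by b that weight is at least exp (- b).\<close>
  have \<psi>_int: "integrable \<mu> (\<lambda>y. indicator A y * \<psi> y)"
    if A: "A \<in> sets borel" "A \<subseteq> {..b}" for A b
  proof (rule Bochner_Integration.integrable_bound)
    show "integrable \<mu> (\<lambda>y. exp b * (\<psi> y * exp (- 1 * y)))"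
      by (intro integrable_mult_right int) simp
    show "AE y in \<mu>. norm (indicator A y * \<psi> y) \<le> norm (exp b * (\<psi> y * exp (- 1 * y)))"
    proof (intro AE_I2)
      fix y
      have "y \<in> A \<Longrightarrow> \<bar>\<psi> y\<bar> * 1 \<le> \<bar>\<psi> y\<bar> * exp (b - y)"
        using A(2) by (intro mult_left_mono) auto
      thus "norm (indicator A y * \<psi> y) \<le> norm (exp b * (\<psi> y * exp (- 1 * y)))"
        by (auto simp: indicator_def abs_mult exp_diff exp_minus field_simps)
    qed
  qed (use A in measurable)
  have "\<exists>C. \<forall>x>0. q x = C * K x"
  proof (rule linear_integral_equation_solution[where \<phi> = "\<lambda>x. \<psi> x / x"])
    show "continuous_on {0<..} (\<lambda>x. \<psi> x / x)" using cont by (intro continuous_intros) auto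
    fix a b :: real assume ab: "0 < a" "a \<le> b"
    have *: "q x / x * indicator {0<..} x * (indicator {a..b} x * \<psi> x) = indicator {a..b} x * (\<psi> x / x * q x)" for x
      using ab by (auto simp: indicator_def)
    show "set_integrable lborel {a..b} (\<lambda>x. \<psi> x / x * q x)"
    proof -
      have "integrable \<mu> (\<lambda>y. indicator {a..b} y * \<psi> y)" by (rule \<psi>_int) auto
      hence "integrable (density lborel (\<lambda>x. ennreal (q x / x * indicator {0<..} x))) (\<lambda>y. indicator {a..b} y * \<psi> y)"
        by (simp only: \<mu>_q[symmetric])
      hence "integrable lborel (\<lambda>x. q x / x * indicator {0<..} x * (indicator {a..b} x * \<psi> x))"
        by (rule iffD1[OF integrable_real_density[OF _ p_nonneg], rotated 2]) measurable
      thus ?thesis by (simp only: * set_integrable_def real_scaleR_def)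
    qed
    \<comment> \<open>The difference of the two half-lines is (a, b], whereas the equation to be
      solved is stated on [a, b]; hence atoms must be excluded.\<close>
    have "emeasure \<mu> {a} = 0" by (subst \<mu>_q) (simp add: emeasure_density nn_integral_0_iff_AE AE_lborel_singleton)
    hence "AE y in \<mu>. y \<noteq> a" by (intro AE_I[of _ _ "{a}"]) (auto simp: sets)
    hence "AE y in \<mu>. indicator {..b} y * \<psi> y - indicator {..a} y * \<psi> y = indicator {a..b} y * \<psi> y"
      by eventually_elim (use ab in \<open>auto simp: indicator_def\<close>)
    hence "(\<integral>y. indicator {..b} y * \<psi> y - indicator {..a} y * \<psi> y \<partial>\<mu>) = (\<integral>y. indicator {a..b} y * \<psi> y \<partial>\<mu>)"
      by (intro integral_cong_AE) auto
    hence "q b - q a = (\<integral>y. indicator {a..b} y * \<psi> y \<partial>\<mu>)"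
      unfolding q_def using \<psi>_int[OF _ order_refl] by simp
    also have "\<dots> = (\<integral>x. q x / x * indicator {0<..} x * (indicator {a..b} x * \<psi> x) \<partial>lborel)"
      by (subst \<mu>_q, rule integral_real_density[OF _ p_nonneg]) measurable
    also have "\<dots> = (LINT x:{a..b}|lborel. \<psi> x / x * q x)"
      by (simp only: * set_lebesgue_integral_def real_scaleR_def)
    finally show "q b - q a = (LINT x:{a..b}|lborel. \<psi> x / x * q x)" .
  qed (use K K' in auto)
  then obtain C where C: "q x = C * K x" if "x > 0" for x by blast
  \<comment> \<open>Because \<open>ennreal\<close> sends negative numbers to 0, a negative constant
    gives the same density as 0, and the sign of \<open>C\<close> need not be determined.\<close>
  have "(\<lambda>x. ennreal (q x / x * indicator {0<..} x))
      = (\<lambda>x. ennreal (max C 0 * (K x / x) * indicator {0<..} x))"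
  proof
    fix x :: real
    have "C \<le> 0 \<Longrightarrow> x > 0 \<Longrightarrow> C * K x / x \<le> 0"
      using K[of x] by (auto intro!: divide_nonpos_pos mult_nonpos_nonneg)
    thus "ennreal (q x / x * indicator {0<..} x) = ennreal (max C 0 * (K x / x) * indicator {0<..} x)"
      using C[of x] by (auto simp: indicator_def max_def ennreal_neg)
  qed
  thus ?thesis using \<mu>_q by (intro exI[of _ "max C 0"]) auto
qed

section \<open>Kummer and gamma type densities\<close>

text \<open>Total mass 1 forces \<open>C\<close> to be the reciprocal of the integral of
  \<open>w\<close>. This also shows that \<open>w\<close> has a nonzero integral, so
  \<open>normalized_density\<close> does not take its junk value.\<close>

lemma distributed_normalized_density:
  fixes X :: "'a \<Rightarrow> real" and w :: "real \<Rightarrow> real"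
  assumes "prob_space M" and X: "X \<in> borel_measurable M" and [measurable]: "w \<in> borel_measurable borel"
    and w: "\<And>x. w x \<ge> 0" and C: "C \<ge> 0"
    and eq: "distr M borel X = density lborel (\<lambda>x. ennreal (C * w x))"
  shows "distributed M lborel X (normalized_density w)" and "C > 0"
proof -
  interpret prob_space M by fact
  interpret D: prob_space "distr M borel X" using X by (rule prob_space_distr)
  have "1 = emeasure (density lborel (\<lambda>x. ennreal (C * w x))) UNIV"
    using D.emeasure_space_1 by (simp add: eq)
  also have "\<dots> = (\<integral>\<^sup>+x. ennreal (C * w x) \<partial>lborel)"
    by (simp add: emeasure_density)
  finally have nn: "(\<integral>\<^sup>+x. ennreal (C * w x) \<partial>lborel) = ennreal 1" by simp
  have "has_bochner_integral lborel (\<lambda>x. C * w x) 1"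
    using w C nn by (intro has_bochner_integral_nn_integral) auto
  hence int: "C * (\<integral>x. w x \<partial>lborel) = 1" by (simp add: has_bochner_integral_iff)
  with C show "C > 0" by (cases "C = 0") auto
  have "normalized_density w = (\<lambda>x. C * w x)"
  proof -
    have "C = 1 / (\<integral>x. w x \<partial>lborel)"
      using int by (metis mult_zero_right nonzero_eq_divide_eq zero_neq_one)
    thus ?thesis by (simp add: normalized_density_def fun_eq_iff)
  qed
  moreover have "distr M lborel X = distr M borel X" by (intro distr_cong) auto
  ultimately show "distributed M lborel X (normalized_density w)"
    unfolding distributed_def using eq X by simp
qed

text \<open>The logarithm is unbounded at both ends of the half-line. Divergence at infinity will
  exclude c = 0, and divergence at 0 will exclude a nonpositive shape parameter.\<close>

lemma nn_integral_inverse_top: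
  fixes S :: "real set"
  assumes S: "S \<in> sets borel" "{1..} \<subseteq> S \<or> {0<..1} \<subseteq> S"
  shows "(\<integral>\<^sup>+x. ennreal (1 / x) * indicator S x \<partial>lborel) = \<infinity>"
proof (rule ccontr)
  assume "(\<integral>\<^sup>+x. ennreal (1 / x) * indicator S x \<partial>lborel) \<noteq> \<infinity>"
  then obtain n :: nat where n: "(\<integral>\<^sup>+x. ennreal (1 / x) * indicator S x \<partial>lborel) < of_nat n"
    using ennreal_Ex_less_of_nat by (auto simp: top.not_eq_extremum infinity_ennreal_def)
  obtain a b :: real where ab: "0 < a" "a \<le> b" "{a..b} \<subseteq> S" "ln b - ln a = n"
  proof (cases "{1..} \<subseteq> S")
    case True
    show ?thesis by (rule that[of 1 "exp n"]) (use True in auto)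
  next
    case False
    with S have "{0<..1} \<subseteq> S" by simp
    moreover have "{exp (- n)..1} \<subseteq> {0<..1}"
      using less_le_trans[OF exp_gt_zero] by auto
    ultimately show ?thesis by (intro that[of "exp (- n)" 1]) auto
  qed
  have "ennreal n = ennreal (ln b - ln a)" using ab by simp
  also have "\<dots> = (\<integral>\<^sup>+x. ennreal (1 / x) * indicator {a..b} x \<partial>lborel)"
    using ab by (intro nn_integral_FTC_Icc[symmetric]) (auto intro!: derivative_eq_intros)
  also have "\<dots> \<le> (\<integral>\<^sup>+x. ennreal (1 / x) * indicator S x \<partial>lborel)"
    using ab by (intro nn_integral_mono mult_left_mono) (auto simp: indicator_def)
  also note n
  finally show False by (simp add: ennreal_of_nat_eq_real_of_nat)
qed

lemma nn_integral_density_ge_inverse: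
  fixes S :: "real set"
  assumes S: "S \<in> sets borel" "{1..} \<subseteq> S \<or> {0<..1} \<subseteq> S" and \<delta>: "\<delta> > 0"
    and [measurable]: "w \<in> borel_measurable borel" and w: "\<And>x. x \<in> S \<Longrightarrow> w x \<ge> \<delta> * (1 / x)"
  shows "(\<integral>\<^sup>+x. ennreal (w x) \<partial>lborel) = \<infinity>"
proof -
  have "ennreal \<delta> * (\<integral>\<^sup>+x. ennreal (1 / x) * indicator S x \<partial>lborel)
      = (\<integral>\<^sup>+x. ennreal \<delta> * (ennreal (1 / x) * indicator S x) \<partial>lborel)"
    using S by (intro nn_integral_cmult[symmetric]) auto
  also have "\<dots> \<le> (\<integral>\<^sup>+x. ennreal (w x) \<partial>lborel)"
    using w \<delta> by (intro nn_integral_mono) (auto simp: indicator_def simp flip: ennreal_mult' intro!: ennreal_leI)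
  finally show ?thesis
    using nn_integral_inverse_top[OF S] \<delta> by (simp add: ennreal_mult_top top_unique)
qed

text \<open>Moving the term with c to the right gives \<psi>(x) = \<theta> - \<kappa> x / (1 + x) -
  c x, so K' / K = \<theta> / x - \<kappa> / (1 + x) - c. This integrates to the displayed powers
  and exponential, and the density K(x) / x lowers the exponent \<theta> by one.\<close>

lemma kummer_type_density:
  fixes \<mu> :: "real measure" and \<theta> \<kappa> c :: real
  assumes "finite_measure \<mu>" and sets[measurable_cong]: "sets \<mu> = sets borel"
    and pos: "AE x in \<mu>. x > 0"
    and eq: "\<And>t. t > 0 \<Longrightarrow> (t + c) * (\<integral>x. x * exp (- t * x) \<partial>\<mu>)
               = \<theta> * (\<integral>x. exp (- t * x) \<partial>\<mu>) - \<kappa> * (\<integral>x. x / (1 + x) * exp (- t * x) \<partial>\<mu>)"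
  shows "\<exists>C\<ge>0. \<mu> = density lborel
           (\<lambda>x. ennreal (C * (x powr (\<theta> - 1) * (1 + x) powr (- \<kappa>) * exp (- c * x) * indicator {0<..} x)))"
proof -
  interpret finite_measure \<mu> by fact
  let ?\<psi> = "\<lambda>x. \<theta> - \<kappa> * (x / (1 + x)) - c * x"
  let ?K = "\<lambda>x. x powr \<theta> * (1 + x) powr (- \<kappa>) * exp (- c * x)"
  have int: "integrable \<mu> (\<lambda>x. exp (- t * x))" "integrable \<mu> (\<lambda>x. x / (1 + x) * exp (- t * x))"
    "integrable \<mu> (\<lambda>x. x * exp (- t * x))" if t: "t > 0" for t
  proof -
    have e: "integrable \<mu> (\<lambda>x. exp (- t * x))" if "t > 0" for t
      using pos that by (intro integrable_const_bound[where B = 1]) (auto elim!: eventually_mono)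
    show "integrable \<mu> (\<lambda>x. exp (- t * x))" by (rule e[OF t])
    have "integrable \<mu> (\<lambda>x. 1 * x * exp (- t * x))"
      using pos t e by (intro laplace_integrable_mult) (auto elim!: eventually_mono)
    thus "integrable \<mu> (\<lambda>x. x * exp (- t * x))" by simp
    show "integrable \<mu> (\<lambda>x. x / (1 + x) * exp (- t * x))"
    proof (rule Bochner_Integration.integrable_bound[OF e[OF t]])
      show "AE x in \<mu>. norm (x / (1 + x) * exp (- t * x)) \<le> norm (exp (- t * x))"
        using pos
      proof eventually_elim
        case (elim x)
        hence "x / (1 + x) * exp (- t * x) \<le> 1 * exp (- t * x)" by (intro mult_right_mono) auto
        thus ?case using elim by simp
      qed
    qed measurable
  qed
  have split: "?\<psi> x * exp (- t * x)
      = \<theta> * exp (- t * x) - \<kappa> * (x / (1 + x) * exp (- t * x)) - c * (x * exp (- t * x))" for x t :: real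
    by (simp add: algebra_simps)
  have "\<exists>C\<ge>0. \<mu> = density lborel (\<lambda>x. ennreal (C * (?K x / x) * indicator {0<..} x))"
  proof (rule density_of_laplace_equation[OF assms(1) sets pos, where \<psi> = ?\<psi>])
    show "continuous_on {0<..} ?\<psi>" by (intro continuous_intros) auto
    show "integrable \<mu> (\<lambda>x. ?\<psi> x * exp (- t * x))" if "t > 0" for t
      unfolding split using int[OF that] by (intro Bochner_Integration.integrable_diff integrable_mult_right)
    show "t * (\<integral>x. x * exp (- t * x) \<partial>\<mu>) = (\<integral>x. ?\<psi> x * exp (- t * x) \<partial>\<mu>)" if "t > 0" for t
    proof -
      have "(\<integral>x. ?\<psi> x * exp (- t * x) \<partial>\<mu>) = \<theta> * (\<integral>x. exp (- t * x) \<partial>\<mu>)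
          - \<kappa> * (\<integral>x. x / (1 + x) * exp (- t * x) \<partial>\<mu>) - c * (\<integral>x. x * exp (- t * x) \<partial>\<mu>)"
        unfolding split using int[OF that] by (simp del: mult_minus_left times_divide_eq_left)
      thus ?thesis using eq[OF that] by (simp add: distrib_right)
    qed
    show "?K x > 0" if "x > 0" for x using that by simp
    show "(?K has_real_derivative ?\<psi> x / x * ?K x) (at x)" if "x > 0" for x
    proof -
      have "(?K has_real_derivative \<theta> * x powr (\<theta> - 1) * ((1 + x) powr (- \<kappa>) * exp (- c * x))
          + x powr \<theta> * (- \<kappa> * (1 + x) powr (- \<kappa> - 1) * exp (- c * x) + (1 + x) powr (- \<kappa>) * (- c * exp (- c * x)))) (at x)"
        using that by (auto intro!: derivative_eq_intros simp: algebra_simps)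
      also have "x powr (\<theta> - 1) = x powr \<theta> / x" using that by (simp add: powr_diff)
      also have "(1 + x) powr (- \<kappa> - 1) = (1 + x) powr (- \<kappa>) / (1 + x)" using that by (simp add: powr_diff)
      finally show ?thesis using that by (simp add: field_simps)
    qed
  qed measurable
  moreover have "C * (?K x / x) * indicator {0<..} x
      = C * (x powr (\<theta> - 1) * (1 + x) powr (- \<kappa>) * exp (- c * x) * indicator {0<..} x)" for C x :: real
    by (auto simp: indicator_def powr_diff)
  ultimately show ?thesis by (simp only:)
qed

text \<open>The case p = \<kappa> = 0 gives the gamma distribution.\<close>
lemma kummer_type_distributed:
  fixes X :: "'a \<Rightarrow> real" and p \<theta> \<kappa> c :: real
  assumes "prob_space M" and [measurable]: "X \<in> borel_measurable M"
    and X: "AE \<omega> in M. X \<omega> > 0"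
    and c: "c \<ge> 0"
    and W_int: "integrable M (\<lambda>\<omega>. (X \<omega> / (1 + X \<omega>)) powr p)"
    and eq: "\<And>t. t > 0 \<Longrightarrow> (t + c) * (\<integral>\<omega>. (X \<omega> / (1 + X \<omega>)) powr p * X \<omega> * exp (- t * X \<omega>) \<partial>M)
      = \<theta> * (\<integral>\<omega>. (X \<omega> / (1 + X \<omega>)) powr p * exp (- t * X \<omega>) \<partial>M)
        - \<kappa> * (\<integral>\<omega>. (X \<omega> / (1 + X \<omega>)) powr (p + 1) * exp (- t * X \<omega>) \<partial>M)"
  defines "w \<equiv> \<lambda>x. x powr (\<theta> - p - 1) * exp (- c * x) / (1 + x) powr (\<kappa> - p) * indicator {0<..} x"
  shows "distributed M lborel X (normalized_density w)"
    and "\<theta> - p > 0" and "\<kappa> - p = 0 \<Longrightarrow> c > 0"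
proof -
  interpret prob_space M by fact
  let ?W = "\<lambda>x::real. (x / (1 + x)) powr p"
  let ?D = "distr M borel X"
  \<comment> \<open>Weighting the law by W powr p, with W = x / (1 + x), turns the factor W powr (p
    + 1) into x / (1 + x), which is the form that \<open>kummer_type_density\<close> requires. The
    weight is almost surely positive and is divided out afterwards.\<close>
  define \<nu> where "\<nu> = density ?D (\<lambda>x. ennreal (?W x))"
  have sets[measurable_cong]: "sets \<nu> = sets borel" by (simp add: \<nu>_def)
  have D_pos: "AE x in ?D. x > 0" using X by (simp add: AE_distr_iff)
  have \<nu>_pos: "AE x in \<nu>. x > 0"
    unfolding \<nu>_def using D_pos by (subst AE_density) (auto elim: eventually_mono)
  have "emeasure \<nu> (space \<nu>) = (\<integral>\<^sup>+\<omega>. ennreal (?W (X \<omega>)) \<partial>M)"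
    by (simp add: \<nu>_def emeasure_density nn_integral_distr)
  also have "\<dots> = ennreal (\<integral>\<omega>. ?W (X \<omega>) \<partial>M)"
    using W_int by (intro nn_integral_eq_integral) auto
  finally have "finite_measure \<nu>" by (intro finite_measureI) simp
  have int: "(\<integral>x. h x \<partial>\<nu>) = (\<integral>\<omega>. ?W (X \<omega>) * h (X \<omega>) \<partial>M)" if [measurable]: "h \<in> borel_measurable borel" for h :: "real \<Rightarrow> real"
    unfolding \<nu>_def by (subst integral_real_density) (auto simp: integral_distr)
  have "(t + c) * (\<integral>x. x * exp (- t * x) \<partial>\<nu>)
      = \<theta> * (\<integral>x. exp (- t * x) \<partial>\<nu>) - \<kappa> * (\<integral>x. x / (1 + x) * exp (- t * x) \<partial>\<nu>)" if "t > 0" for t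
  proof -
    have "(\<integral>\<omega>. ?W (X \<omega>) * (X \<omega> / (1 + X \<omega>) * exp (- t * X \<omega>)) \<partial>M)
        = (\<integral>\<omega>. (X \<omega> / (1 + X \<omega>)) powr (p + 1) * exp (- t * X \<omega>) \<partial>M)"
    proof (rule integral_cong_AE)
      show "AE \<omega> in M. ?W (X \<omega>) * (X \<omega> / (1 + X \<omega>) * exp (- t * X \<omega>))
          = (X \<omega> / (1 + X \<omega>)) powr (p + 1) * exp (- t * X \<omega>)"
        using X by eventually_elim (simp add: powr_add)
    qed measurable
    thus ?thesis using eq[OF that] by (simp add: int mult.assoc)
  qed
  from kummer_type_density[OF \<open>finite_measure \<nu>\<close> sets \<nu>_pos this]
  obtain C where C: "C \<ge> 0" and \<nu>: "\<nu> = density lborel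
      (\<lambda>x. ennreal (C * (x powr (\<theta> - 1) * (1 + x) powr (- \<kappa>) * exp (- c * x) * indicator {0<..} x)))"
    by blast
  have w_meas[measurable]: "w \<in> borel_measurable borel" unfolding w_def by measurable
  have w_nonneg: "w x \<ge> 0" for x by (auto simp: w_def indicator_def)
  have "?D = density \<nu> (\<lambda>x. ennreal (inverse (?W x)))"
  proof -
    have "density \<nu> (\<lambda>x. ennreal (inverse (?W x))) = density ?D (\<lambda>_. 1)"
      unfolding \<nu>_def using D_pos
      by (subst density_density_eq) (auto intro!: density_cong elim!: eventually_mono simp flip: ennreal_mult'')
    thus ?thesis by (simp add: density_1)
  qed
  also have "\<dots> = density lborel (\<lambda>x. ennreal (C * w x))"
    unfolding \<nu>
  proof (subst density_density_eq; (intro density_cong AE_I2)?)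
    fix x :: real
    show "ennreal (C * (x powr (\<theta> - 1) * (1 + x) powr (- \<kappa>) * exp (- c * x) * indicator {0<..} x)) * ennreal (inverse (?W x))
        = ennreal (C * w x)"
    proof (cases "x > 0")
      case True
      have "x powr (\<theta> - 1) * (1 + x) powr (- \<kappa>) * inverse (?W x) = x powr (\<theta> - p - 1) / (1 + x) powr (\<kappa> - p)"
      proof -
        have 1: "x powr (\<theta> - p - 1) = x powr (\<theta> - 1) / x powr p"
          using powr_diff[of x "\<theta> - 1" p] by (simp add: algebra_simps)
        have 2: "(1 + x) powr (\<kappa> - p) = (1 + x) powr \<kappa> / (1 + x) powr p"
          by (rule powr_diff)
        have 3: "?W x = x powr p / (1 + x) powr p" by (rule powr_divide)
        show ?thesis unfolding 1 2 3 powr_minus by (simp add: divide_simps)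
      qed
      hence "C * (x powr (\<theta> - 1) * (1 + x) powr (- \<kappa>) * exp (- c * x)) * inverse (?W x)
          = C * (x powr (\<theta> - p - 1) * exp (- c * x) / (1 + x) powr (\<kappa> - p))"
        by (simp add: field_simps)
      thus ?thesis using True C by (simp add: w_def flip: ennreal_mult'')
    qed (simp add: w_def)
  qed measurable
  finally have D: "?D = density lborel (\<lambda>x. ennreal (C * w x))" .
  note dist = distributed_normalized_density[OF assms(1,2) w_meas w_nonneg C D]
  show "distributed M lborel X (normalized_density w)" by (rule dist(1))
  have C_pos: "C > 0" by (rule dist(2))
  have "emeasure ?D UNIV = 1"
    using prob_space.emeasure_space_1[OF prob_space_distr[of X borel]] by simp
  hence total: "(\<integral>\<^sup>+x. ennreal (C * w x) \<partial>lborel) = 1"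
    by (simp add: D emeasure_density)
  show "\<theta> - p > 0"
  proof (rule ccontr)
    assume neg: "\<not> \<theta> - p > 0"
    \<comment> \<open>On (0, 1] the exponential is at least exp (- c), as c \<ge> 0, and the power
      of 1 + x is at most 2 powr \<bar>\<kappa> - p\<bar>. What remains is at least 1 / x when
      \<theta> \<le> p.\<close>
    let ?\<delta> = "C * (exp (- c) / 2 powr \<bar>\<kappa> - p\<bar>)"
    have "(\<integral>\<^sup>+x. ennreal (C * w x) \<partial>lborel) = \<infinity>"
    proof (rule nn_integral_density_ge_inverse[of "{0<..1}" ?\<delta>])
      fix x :: real assume "x \<in> {0<..1}"
      hence x: "0 < x" "x \<le> 1" by auto
      have "1 / x = x powr (- 1)" using x by (simp add: powr_minus field_simps)
      also have "\<dots> \<le> x powr (\<theta> - p - 1)"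
        using x neg by (intro powr_mono') auto
      finally have 1: "1 / x \<le> x powr (\<theta> - p - 1)" .
      have 2: "exp (- c) \<le> exp (- c * x)" using c x by (simp add: mult_left_le)
      have "(1 + x) powr (\<kappa> - p) \<le> (1 + x) powr \<bar>\<kappa> - p\<bar>" using x by (intro powr_mono) auto
      also have "\<dots> \<le> 2 powr \<bar>\<kappa> - p\<bar>" using x by (intro powr_mono2) auto
      finally have 3: "(1 + x) powr (\<kappa> - p) \<le> 2 powr \<bar>\<kappa> - p\<bar>" .
      have "1 / x * exp (- c) / 2 powr \<bar>\<kappa> - p\<bar> \<le> x powr (\<theta> - p - 1) * exp (- c * x) / (1 + x) powr (\<kappa> - p)"
        using x by (intro frac_le mult_mono 1 2 3) auto
      from mult_left_mono[OF this C] show "?\<delta> * (1 / x) \<le> C * w x"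
        using x by (simp add: w_def mult_ac)
    qed (use C_pos in auto)
    with total show False by simp
  qed
  \<comment> \<open>With c = 0 and \<kappa> = p only the power x powr (\<theta> - p - 1) is left. By
    the inequality just proved its tail is at least 1 / x, which contradicts total mass 1.\<close>
  show "c > 0" if "\<kappa> - p = 0"
  proof (rule ccontr)
    assume "\<not> c > 0"
    with c have c0: "c = 0" by simp
    have "(\<integral>\<^sup>+x. ennreal (C * w x) \<partial>lborel) = \<infinity>"
    proof (rule nn_integral_density_ge_inverse[of "{1..}" C])
      fix x :: real assume "x \<in> {1..}"
      hence x: "1 \<le> x" by auto
      have "1 / x = x powr (- 1)" using x by (simp add: powr_minus field_simps)
      also have "\<dots> \<le> x powr (\<theta> - p - 1)"
        using x \<open>\<theta> - p > 0\<close> by (intro powr_mono) auto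
      also have "\<dots> = w x" using x c0 that by (simp add: w_def)
      finally show "C * (1 / x) \<le> C * w x" using C by (rule mult_left_mono)
    qed (use C_pos in auto)
    with total show False by simp
  qed
qed

section \<open>The regression equations\<close>

text \<open>The ratio lies in (0, 1), so only negative powers are critical, and only near X = 0,
  where the ratio is comparable to X. The moment assumption for r < 1 enters here.\<close>

lemma integrable_ratio_powr:
  fixes X :: "'a \<Rightarrow> real"
  assumes "prob_space M" and [measurable]: "X \<in> borel_measurable M"
    and pos: "AE \<omega> in M. X \<omega> > 0"
    and int: "p < 0 \<Longrightarrow> integrable M (\<lambda>\<omega>. X \<omega> powr p)"
  shows "integrable M (\<lambda>\<omega>. (X \<omega> / (1 + X \<omega>)) powr p)"
proof (cases "p < 0")
  case False
  interpret prob_space M by fact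
  show ?thesis
    using pos False by (intro integrable_const_bound[where B = 1])
      (auto elim!: eventually_mono intro!: powr_le1)
next
  case True
  interpret prob_space M by fact
  show ?thesis
  proof (rule Bochner_Integration.integrable_bound)
    show "integrable M (\<lambda>\<omega>. 2 powr (- p) * (1 + X \<omega> powr p))"
      using int[OF True] by simp
    show "AE \<omega> in M. norm ((X \<omega> / (1 + X \<omega>)) powr p) \<le> norm (2 powr (- p) * (1 + X \<omega> powr p))"
      using pos
    proof eventually_elim
      case (elim \<omega>)
      let ?x = "X \<omega>"
      have "min 1 ?x / 2 \<le> ?x / (1 + ?x)"
        using elim by (auto simp: field_simps min_def)
      hence "(?x / (1 + ?x)) powr p \<le> (min 1 ?x / 2) powr p"
        using elim True by (intro powr_mono2') auto
      also have "\<dots> = 2 powr (- p) * min 1 ?x powr p"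
        using elim by (simp add: powr_divide powr_minus field_simps)
      also have "\<dots> \<le> 2 powr (- p) * (1 + ?x powr p)"
        by (intro mult_left_mono) (auto simp: min_def)
      finally show ?case by simp
    qed
  qed measurable
qed

text \<open>In the test function the power of V / (1 + V) cancels the V-part of U powr (s - 1), and
  the factor V clears the denominator of one further U = W (1 + V) / V. The products become V exp (-
  t V) W powr (s - 1) and (1 + V) exp (- t V) W powr s, both of which split into sums of a function
  of X times a function of Y.\<close>

lemma regression_laplace_equation:
  fixes X Y :: "'a \<Rightarrow> real" and s t \<alpha> :: real
  assumes "prob_space M" and indep: "prob_space.indep_var M borel X borel Y"
    and X: "AE \<omega> in M. X \<omega> > 0" and Y: "AE \<omega> in M. Y \<omega> > 0"
    and W_int: "integrable M (\<lambda>\<omega>. (X \<omega> / (1 + X \<omega>)) powr (s - 1))"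
  defines "U \<equiv> \<lambda>\<omega>. (1 + 1 / (X \<omega> + Y \<omega>)) / (1 + 1 / X \<omega>)" and "V \<equiv> \<lambda>\<omega>. X \<omega> + Y \<omega>"
  assumes reg: "AE \<omega> in M. cond_exp_given M (\<lambda>\<omega>. U \<omega> powr s) V \<omega>
             = \<alpha> * cond_exp_given M (\<lambda>\<omega>. U \<omega> powr (s - 1)) V \<omega>"
    and t: "t > 0"
  defines "W \<equiv> \<lambda>p \<omega>. (X \<omega> / (1 + X \<omega>)) powr p"
  shows "(\<integral>\<omega>. W (s - 1) \<omega> * X \<omega> * exp (- t * X \<omega>) \<partial>M) * (\<integral>\<omega>. exp (- t * Y \<omega>) \<partial>M)
        + (\<integral>\<omega>. W s \<omega> * exp (- t * X \<omega>) \<partial>M) * (\<integral>\<omega>. Y \<omega> * exp (- t * Y \<omega>) \<partial>M)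
    = \<alpha> * ((\<integral>\<omega>. W (s - 1) \<omega> * X \<omega> * exp (- t * X \<omega>) \<partial>M) * (\<integral>\<omega>. exp (- t * Y \<omega>) \<partial>M)
        + (\<integral>\<omega>. W (s - 1) \<omega> * exp (- t * X \<omega>) \<partial>M) * (\<integral>\<omega>. Y \<omega> * exp (- t * Y \<omega>) \<partial>M))"
proof -
  interpret prob_space M by fact
  have [measurable]: "X \<in> borel_measurable M" "Y \<in> borel_measurable M"
    using indep_var_rv1[OF indep] indep_var_rv2[OF indep] by auto
  have [measurable]: "V \<in> borel_measurable M" "W p \<in> borel_measurable M" "U \<in> borel_measurable M" for p
    unfolding V_def W_def U_def by measurable
  have prod: "integrable M (\<lambda>\<omega>. h (X \<omega>) * k (Y \<omega>))"
    "(\<integral>\<omega>. h (X \<omega>) * k (Y \<omega>) \<partial>M) = (\<integral>\<omega>. h (X \<omega>) \<partial>M) * (\<integral>\<omega>. k (Y \<omega>) \<partial>M)"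
    if "h \<in> borel_measurable borel" "k \<in> borel_measurable borel"
      "integrable M (\<lambda>\<omega>. h (X \<omega>))" "integrable M (\<lambda>\<omega>. k (Y \<omega>))" for h k :: "real \<Rightarrow> real"
    using indep_var_lebesgue_integral[OF indep_var_compose[OF indep that(1,2), unfolded comp_def] that(3,4)]
      indep_var_integrable[OF indep_var_compose[OF indep that(1,2), unfolded comp_def] that(3,4)]
    by simp_all
  have W_bound: "AE \<omega> in M. W s \<omega> \<le> W (s - 1) \<omega>"
    using X by eventually_elim (auto simp: W_def intro!: powr_mono')
  have eX: "integrable M (\<lambda>\<omega>. W (s - 1) \<omega> * exp (- t * X \<omega>))" if "t > 0" for t
  proof (rule Bochner_Integration.integrable_bound)
    show "integrable M (W (s - 1))" using W_int by (simp add: W_def)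
    show "AE \<omega> in M. norm (W (s - 1) \<omega> * exp (- t * X \<omega>)) \<le> norm (W (s - 1) \<omega>)"
      using X that by (auto elim!: eventually_mono intro!: mult_left_le simp: W_def)
  qed measurable
  have eX': "integrable M (\<lambda>\<omega>. W s \<omega> * exp (- t * X \<omega>))"
  proof (rule Bochner_Integration.integrable_bound[OF eX[OF t]])
    show "AE \<omega> in M. norm (W s \<omega> * exp (- t * X \<omega>)) \<le> norm (W (s - 1) \<omega> * exp (- t * X \<omega>))"
      using W_bound by (auto elim!: eventually_mono simp: W_def)
  qed measurable
  have XX: "integrable M (\<lambda>\<omega>. W (s - 1) \<omega> * X \<omega> * exp (- t * X \<omega>))"
    using X eX t by (intro laplace_integrable_mult) (auto elim!: eventually_mono)
  have eY: "integrable M (\<lambda>\<omega>. exp (- t * Y \<omega>))" if "t > 0" for t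
    using Y that by (intro integrable_const_bound[where B = 1]) (auto elim!: eventually_mono)
  have "integrable M (\<lambda>\<omega>. 1 * Y \<omega> * exp (- t * Y \<omega>))"
    using Y eY t by (intro laplace_integrable_mult) (auto elim!: eventually_mono)
  hence YY: "integrable M (\<lambda>\<omega>. Y \<omega> * exp (- t * Y \<omega>))" by simp
  note XX_Y = prod[of "\<lambda>x. (x / (1 + x)) powr (s - 1) * x * exp (- t * x)" "\<lambda>y. exp (- t * y)",
      OF _ _ XX[unfolded W_def] eY[OF t]]
  note X_YY = prod[of "\<lambda>x. (x / (1 + x)) powr (s - 1) * exp (- t * x)" "\<lambda>y. y * exp (- t * y)",
      OF _ _ eX[OF t, unfolded W_def] YY]
  note X'_YY = prod[of "\<lambda>x. (x / (1 + x)) powr s * exp (- t * x)" "\<lambda>y. y * exp (- t * y)",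
      OF _ _ eX'[unfolded W_def] YY]

  let ?F = "vimage_algebra (space M) V borel"
  have sub: "subalgebra M ?F"
    unfolding subalgebra_def by (auto simp: sets_vimage_algebra2)
  interpret S: finite_measure_subalgebra M ?F
    by unfold_locales (rule sub)
  define h where "h \<omega> = V \<omega> * exp (- t * V \<omega>) * (V \<omega> / (1 + V \<omega>)) powr (s - 1)" for \<omega>
  have "V \<in> borel_measurable ?F" by (rule measurable_vimage_algebra1) auto
  hence h_meas: "h \<in> borel_measurable ?F" unfolding h_def by measurable
  let ?num = "\<lambda>\<omega>. W (s - 1) \<omega> * X \<omega> * exp (- t * X \<omega>) * exp (- t * Y \<omega>)
                    + W s \<omega> * exp (- t * X \<omega>) * (Y \<omega> * exp (- t * Y \<omega>))"
  let ?den = "\<lambda>\<omega>. W (s - 1) \<omega> * X \<omega> * exp (- t * X \<omega>) * exp (- t * Y \<omega>)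
                    + W (s - 1) \<omega> * exp (- t * X \<omega>) * (Y \<omega> * exp (- t * Y \<omega>))"
  have AE_eq: "AE \<omega> in M. h \<omega> * U \<omega> powr s = ?num \<omega> \<and> h \<omega> * U \<omega> powr (s - 1) = ?den \<omega>"
    using X Y
  proof eventually_elim
    case (elim \<omega>)
    let ?x = "X \<omega>" and ?y = "Y \<omega>" and ?v = "V \<omega>"
    have v: "?v = ?x + ?y" "?v > 0" using elim by (auto simp: V_def)
    have E: "exp (- t * ?v) = exp (- t * ?x) * exp (- t * ?y)"
      by (simp add: v(1) algebra_simps flip: exp_add)
    have U: "U \<omega> = ?x / (1 + ?x) * ((1 + ?v) / ?v)"
      using elim v by (simp add: U_def field_simps)
    have ratio: "((1 + ?v) / ?v) powr (s - 1) * (?v / (1 + ?v)) powr (s - 1) = 1"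
      using v by (simp flip: powr_mult)
    have Up: "U \<omega> powr (s - 1) = W (s - 1) \<omega> * ((1 + ?v) / ?v) powr (s - 1)"
      unfolding U W_def by (rule powr_mult)
    have "U \<omega> > 0" unfolding U using elim v by simp
    hence "U \<omega> powr s = U \<omega> * U \<omega> powr (s - 1)"
      by (simp add: powr_mult_base)
    have Ws: "W s \<omega> = ?x / (1 + ?x) * W (s - 1) \<omega>"
      using elim powr_mult_base[of "?x / (1 + ?x)" "s - 1"] by (simp add: W_def)
    have den: "h \<omega> * U \<omega> powr (s - 1) = ?v * exp (- t * ?v) * W (s - 1) \<omega>"
      using ratio unfolding Up h_def by algebra
    have "h \<omega> * U \<omega> powr s = U \<omega> * (h \<omega> * U \<omega> powr (s - 1))"
      using \<open>U \<omega> powr s = _\<close> by simp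
    also have "\<dots> = (1 + ?v) * exp (- t * ?v) * W s \<omega>"
      unfolding den unfolding U Ws using v(2) by simp
    also have "\<dots> = ?num \<omega>"
    proof -
      \<comment> \<open>This is (1 + x) W = x, applied to 1 + v = (1 + x) + y; it makes the
        numerator a sum of products.\<close>
      have "(1 + ?v) * W s \<omega> = W (s - 1) \<omega> * ?x + W s \<omega> * ?y"
        unfolding v(1) Ws using elim by (simp add: field_simps)
      thus ?thesis unfolding E by algebra
    qed
    finally have "h \<omega> * U \<omega> powr s = ?num \<omega>" .
    moreover have "h \<omega> * U \<omega> powr (s - 1) = ?den \<omega>"
      unfolding den E unfolding v(1) by (simp add: algebra_simps)
    ultimately show ?case by simp
  qed
  have num: "integrable M ?num" and den: "integrable M ?den"
    using XX_Y(1) X_YY(1) X'_YY(1) by (auto simp: W_def)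
  have [measurable]: "h \<in> borel_measurable M"
    using h_meas sub by (rule measurable_from_subalg[rotated])
  have AE_num: "AE \<omega> in M. h \<omega> * U \<omega> powr s = ?num \<omega>"
    and AE_den: "AE \<omega> in M. h \<omega> * U \<omega> powr (s - 1) = ?den \<omega>"
    using AE_eq by (auto elim: eventually_mono)
  have num': "integrable M (\<lambda>\<omega>. h \<omega> * U \<omega> powr s)"
    by (rule iffD2[OF integrable_cong_AE[OF _ _ AE_num] num]) measurable
  have den': "integrable M (\<lambda>\<omega>. h \<omega> * U \<omega> powr (s - 1))"
    by (rule iffD2[OF integrable_cong_AE[OF _ _ AE_den] den]) measurable
  \<comment> \<open>The averaging property of conditional expectation is applied to the products
    with \<open>h\<close> and asks for integrability of these products only.\<close>
  note cn = S.real_cond_exp_intg[OF num' h_meas] and cd = S.real_cond_exp_intg[OF den' h_meas]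
  have "(\<integral>\<omega>. h \<omega> * real_cond_exp M ?F (\<lambda>\<omega>. U \<omega> powr s) \<omega> \<partial>M)
      = (\<integral>\<omega>. \<alpha> * (h \<omega> * real_cond_exp M ?F (\<lambda>\<omega>. U \<omega> powr (s - 1)) \<omega>) \<partial>M)"
    using reg unfolding cond_exp_given_def by (intro integral_cong_AE) (auto elim!: eventually_mono)
  hence "(\<integral>\<omega>. h \<omega> * U \<omega> powr s \<partial>M) = \<alpha> * (\<integral>\<omega>. h \<omega> * U \<omega> powr (s - 1) \<partial>M)"
    using cn(2) cd(2) by simp
  moreover have "(\<integral>\<omega>. h \<omega> * U \<omega> powr s \<partial>M) = (\<integral>\<omega>. ?num \<omega> \<partial>M)"
    by (rule integral_cong_AE[OF _ _ AE_num]) measurable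
  moreover have "(\<integral>\<omega>. h \<omega> * U \<omega> powr (s - 1) \<partial>M) = (\<integral>\<omega>. ?den \<omega> \<partial>M)"
    by (rule integral_cong_AE[OF _ _ AE_den]) measurable
  ultimately show ?thesis
    using XX_Y X_YY X'_YY by (simp add: W_def)
qed

text \<open>In the application f, g, k are the Laplace transforms of X weighted by the powers r - 1, r, r + 1
  of X / (1 + X), and m is the Laplace transform of Y. The names fd, fdd, ... stand for the derivatives
  up to sign, taken so that all functions are positive.\<close>
lemma regression_constants:
  fixes f fd fdd g gd gdd k kd m md mdd :: "real \<Rightarrow> real" and \<alpha> \<beta> :: real
  assumes pos: "\<And>t. t > 0 \<Longrightarrow> g t > 0" "\<And>t. t > 0 \<Longrightarrow> g t < f t" "\<And>t. t > 0 \<Longrightarrow> k t > 0" "\<And>t. t > 0 \<Longrightarrow> k t < g t"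
      "\<And>t. t > 0 \<Longrightarrow> fd t > 0" "\<And>t. t > 0 \<Longrightarrow> gd t > 0" "\<And>t. t > 0 \<Longrightarrow> m t > 0" "\<And>t. t > 0 \<Longrightarrow> md t > 0"
    and CS: "\<And>t. t > 0 \<Longrightarrow> md t * md t < m t * mdd t"
    and deriv:
      "\<And>t. t > 0 \<Longrightarrow> (f has_real_derivative - fd t) (at t)"
      "\<And>t. t > 0 \<Longrightarrow> (fd has_real_derivative - fdd t) (at t)"
      "\<And>t. t > 0 \<Longrightarrow> (g has_real_derivative - gd t) (at t)"
      "\<And>t. t > 0 \<Longrightarrow> (gd has_real_derivative - gdd t) (at t)"
      "\<And>t. t > 0 \<Longrightarrow> (k has_real_derivative - kd t) (at t)"
      "\<And>t. t > 0 \<Longrightarrow> (m has_real_derivative - md t) (at t)"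
      "\<And>t. t > 0 \<Longrightarrow> (md has_real_derivative - mdd t) (at t)"
    and rel: "\<And>t. t > 0 \<Longrightarrow> fd t = g t + gd t" "\<And>t. t > 0 \<Longrightarrow> gd t = k t + kd t" "\<And>t. t > 0 \<Longrightarrow> fdd t = gd t + gdd t"
    and eq: "\<And>t. t > 0 \<Longrightarrow> fd t * m t + g t * md t = \<alpha> * (fd t * m t + f t * md t)"
      "\<And>t. t > 0 \<Longrightarrow> gd t * m t + k t * md t = \<beta> * (gd t * m t + g t * md t)"
  shows "0 < \<alpha>" "\<alpha> < 1" "0 < \<beta>" "\<beta> < 1" "\<alpha> < \<beta>"
    and "\<exists>c\<ge>0. \<forall>t>0. (t + c) * md t = (1 - \<alpha>) * (1 - \<beta>) / (\<beta> - \<alpha>) * m t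
           \<and> (t + c) * fd t = (1 - \<beta>) / (\<beta> - \<alpha>) * (\<alpha> * f t - g t)"
proof -
  \<comment> \<open>Solved for a, the relation is a quotient of positive sums whose numerator is the
    smaller one because v < u.\<close>
  have unit: "0 < a \<and> a < 1"
    if "p * m0 + v * m1 = a * (p * m0 + u * m1)" "0 < v" "v < u" "0 < p" "0 < m0" "0 < m1"
    for a p u v m0 m1 :: real
  proof -
    have "0 < p * m0" "0 < v * m1" "v * m1 < u * m1" using that by auto
    moreover from this have "a = (p * m0 + v * m1) / (p * m0 + u * m1)"
      using that(1) by (simp add: field_simps)
    ultimately show ?thesis by simp
  qed
  show \<alpha>: "0 < \<alpha>" "\<alpha> < 1" and \<beta>: "0 < \<beta>" "\<beta> < 1"
    using unit[OF eq(1)[of 1]] unit[OF eq(2)[of 1]] pos[of 1] by auto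
  define n where "n t = m t / md t" for t
  define n' where "n' t = (m t * mdd t - md t * md t) / (md t * md t)" for t
  have n_pos: "n t > 0" and n'_pos: "n' t > 0" if "t > 0" for t
    using pos(7,8)[OF that] CS[OF that] by (auto simp: n_def n'_def)
  have n_deriv: "(n has_real_derivative n' t) (at t)" if "t > 0" for t
    unfolding n_def n'_def using pos(8)[OF that]
    by (auto intro!: derivative_eq_intros deriv[OF that])
  \<comment> \<open>Division by \<open>md\<close> leaves \<open>n\<close> as the only trace of
    Y.\<close>
  have E1: "\<alpha> * f t - (1 - \<alpha>) * (n t * fd t) = g t" and E2: "\<beta> * g t - (1 - \<beta>) * (n t * gd t) = k t"
    if "t > 0" for t
  proof -
    have n: "n t * md t = m t" using pos(8)[OF that] by (simp add: n_def)
    have "md t * (\<alpha> * f t - (1 - \<alpha>) * (n t * fd t)) = md t * g t"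
      using eq(1)[OF that] unfolding n[symmetric] by algebra
    thus "\<alpha> * f t - (1 - \<alpha>) * (n t * fd t) = g t" using pos(8)[OF that] by simp
    have "md t * (\<beta> * g t - (1 - \<beta>) * (n t * gd t)) = md t * k t"
      using eq(2)[OF that] unfolding n[symmetric] by algebra
    thus "\<beta> * g t - (1 - \<beta>) * (n t * gd t) = k t" using pos(8)[OF that] by simp
  qed
  have n'_eq: "n' t * ((1 - \<alpha>) * (1 - \<beta>)) = \<beta> - \<alpha>" if t: "t > 0" for t
  proof -
    have "((\<lambda>t. \<alpha> * f t - (1 - \<alpha>) * (n t * fd t)) has_real_derivative
             \<alpha> * - fd t - (1 - \<alpha>) * (n' t * fd t + - fdd t * n t)) (at t)"
      by (intro DERIV_diff DERIV_cmult DERIV_mult deriv n_deriv t)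
    hence "(g has_real_derivative \<alpha> * - fd t - (1 - \<alpha>) * (n' t * fd t + - fdd t * n t)) (at t)"
      by (rule has_field_derivative_transform_within_open[where S = "{0<..}"]) (use t E1 in auto)
    from DERIV_unique[OF this deriv(3)[OF t]]
    have 1: "\<alpha> * - fd t - (1 - \<alpha>) * (n' t * fd t + - fdd t * n t) = - gd t" .
    have "((\<lambda>t. \<beta> * g t - (1 - \<beta>) * (n t * gd t)) has_real_derivative
             \<beta> * - gd t - (1 - \<beta>) * (n' t * gd t + - gdd t * n t)) (at t)"
      by (intro DERIV_diff DERIV_cmult DERIV_mult deriv n_deriv t)
    hence "(k has_real_derivative \<beta> * - gd t - (1 - \<beta>) * (n' t * gd t + - gdd t * n t)) (at t)"
      by (rule has_field_derivative_transform_within_open[where S = "{0<..}"]) (use t E2 in auto)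
    from DERIV_unique[OF this deriv(5)[OF t]]
    have 2: "\<beta> * - gd t - (1 - \<beta>) * (n' t * gd t + - gdd t * n t) = - kd t" .
    \<comment> \<open>Put A = n' gd - n fdd - gd. With \<open>rel\<close> and \<open>E2\<close> the
      differentiated equations become (1 - \<alpha>) (n' g + A) = - \<alpha> g and (1 - \<beta>) A =
      - \<beta> g; eliminating A leaves this identity.\<close>
    have "g t * (n' t * ((1 - \<alpha>) * (1 - \<beta>)) - (\<beta> - \<alpha>)) = 0"
      using 1 2 rel[OF t] E2[OF t] by algebra
    thus ?thesis using pos(1)[OF t] by simp
  qed
  have "0 < \<beta> - \<alpha>" using n'_eq[of 1] n'_pos[of 1] \<alpha> \<beta> by (metis diff_gt_0_iff_gt mult_pos_pos zero_less_one)
  thus "\<alpha> < \<beta>" by simp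
  define D where "D = (\<beta> - \<alpha>) / ((1 - \<alpha>) * (1 - \<beta>))"
  have D: "D > 0" using \<open>0 < \<beta> - \<alpha>\<close> \<alpha> \<beta> by (simp add: D_def)
  have n'_D: "n' t = D" if "t > 0" for t
    using n'_eq[OF that] \<alpha> \<beta> by (simp add: D_def eq_divide_eq)
  have "\<exists>d. \<forall>t\<in>{0<..}. n t - D * t = d"
  proof (rule has_field_derivative_zero_constant)
    fix t :: real assume "t \<in> {0<..}"
    hence t: "t > 0" by simp
    have "((\<lambda>t. n t - D * t) has_real_derivative 0) (at t)"
      using n'_D[OF t] by (auto intro!: derivative_eq_intros n_deriv[OF t])
    thus "((\<lambda>t. n t - D * t) has_real_derivative 0) (at t within {0<..})"
      by (rule has_field_derivative_at_within)
  qed simp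
  then obtain d where "n t - D * t = d" if "t > 0" for t by auto
  hence d: "n t = D * t + d" if "t > 0" for t using that by (metis diff_add_cancel add.commute)
  have "d \<ge> 0"
  proof (rule ccontr)
    assume "\<not> d \<ge> 0"
    \<comment> \<open>At this argument the affine function would equal d / 2 < 0, although
      \<open>n\<close> is positive.\<close>
    hence "- d / (2 * D) > 0" using D by (simp add: field_simps)
    from n_pos[OF this] d[OF this] D \<open>\<not> d \<ge> 0\<close> show False by (simp add: field_simps)
  qed
  \<comment> \<open>The constant c is the intercept of \<open>n\<close> divided by its slope. The
    first equation is the definition of \<open>n\<close>, the second is \<open>E1\<close>.\<close>
  have *: "(t + d / D) * md t = (1 - \<alpha>) * (1 - \<beta>) / (\<beta> - \<alpha>) * m t
           \<and> (t + d / D) * fd t = (1 - \<beta>) / (\<beta> - \<alpha>) * (\<alpha> * f t - g t)" if t: "t > 0" for t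
  proof
    have n: "t + d / D = n t / D" using d[OF t] D by (simp add: field_simps)
    show "(t + d / D) * md t = (1 - \<alpha>) * (1 - \<beta>) / (\<beta> - \<alpha>) * m t"
      unfolding n unfolding n_def D_def using pos(8)[OF t] by simp
    have "\<alpha> * f t - g t = (1 - \<alpha>) * (n t * fd t)" using E1[OF t] by simp
    thus "(t + d / D) * fd t = (1 - \<beta>) / (\<beta> - \<alpha>) * (\<alpha> * f t - g t)"
      unfolding n unfolding D_def using \<alpha> by simp
  qed
  show "\<exists>c\<ge>0. \<forall>t>0. (t + c) * md t = (1 - \<alpha>) * (1 - \<beta>) / (\<beta> - \<alpha>) * m t
           \<and> (t + c) * fd t = (1 - \<beta>) / (\<beta> - \<alpha>) * (\<alpha> * f t - g t)"
    using * \<open>d \<ge> 0\<close> D by (intro exI[of _ "d / D"]) auto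
qed

text \<open>With M0, M1, M2 the weighted moments, the expectation of (M0 Y - M1)^2 exp (- t Y)
  equals M0 (M0 M2 - M1^2). If this were not positive, Y would be almost surely M1 / M0.\<close>

lemma laplace_second_moment_strict:
  fixes Y :: "'a \<Rightarrow> real"
  assumes "prob_space M" and [measurable]: "Y \<in> borel_measurable M"
    and "nondegenerate M Y"
    and int: "integrable M (\<lambda>\<omega>. exp (- t * Y \<omega>))" "integrable M (\<lambda>\<omega>. Y \<omega> * exp (- t * Y \<omega>))"
      "integrable M (\<lambda>\<omega>. Y \<omega> * Y \<omega> * exp (- t * Y \<omega>))"
    and pos: "(\<integral>\<omega>. exp (- t * Y \<omega>) \<partial>M) > 0"
  shows "(\<integral>\<omega>. Y \<omega> * exp (- t * Y \<omega>) \<partial>M) * (\<integral>\<omega>. Y \<omega> * exp (- t * Y \<omega>) \<partial>M)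
       < (\<integral>\<omega>. exp (- t * Y \<omega>) \<partial>M) * (\<integral>\<omega>. Y \<omega> * Y \<omega> * exp (- t * Y \<omega>) \<partial>M)"
proof (rule ccontr)
  define M0 M1 M2 where "M0 = (\<integral>\<omega>. exp (- t * Y \<omega>) \<partial>M)"
    and "M1 = (\<integral>\<omega>. Y \<omega> * exp (- t * Y \<omega>) \<partial>M)" and "M2 = (\<integral>\<omega>. Y \<omega> * Y \<omega> * exp (- t * Y \<omega>) \<partial>M)"
  note M_def = this
  assume "\<not> ?thesis"
  hence le: "M0 * M2 - M1 * M1 \<le> 0" by (simp add: M_def)
  let ?q = "\<lambda>\<omega>. (M0 * Y \<omega> - M1)\<^sup>2 * exp (- t * Y \<omega>)"
  have split: "?q = (\<lambda>\<omega>. M0 * M0 * (Y \<omega> * Y \<omega> * exp (- t * Y \<omega>)) - 2 * M0 * M1 * (Y \<omega> * exp (- t * Y \<omega>))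
      + M1 * M1 * exp (- t * Y \<omega>))"
    by (simp add: fun_eq_iff power2_eq_square algebra_simps)
  have q_int: "integrable M ?q"
    unfolding split using int by (intro Bochner_Integration.integrable_add Bochner_Integration.integrable_diff integrable_mult_right)
  have "(\<integral>\<omega>. ?q \<omega> \<partial>M) = M0 * M0 * (\<integral>\<omega>. Y \<omega> * Y \<omega> * exp (- t * Y \<omega>) \<partial>M)
      - 2 * M0 * M1 * (\<integral>\<omega>. Y \<omega> * exp (- t * Y \<omega>) \<partial>M) + M1 * M1 * (\<integral>\<omega>. exp (- t * Y \<omega>) \<partial>M)"
    unfolding split using int by simp
  also have "\<dots> = M0 * (M0 * M2 - M1 * M1)"
    unfolding M_def[symmetric] by (simp add: algebra_simps)
  also have "\<dots> \<le> 0" using le pos by (intro mult_nonneg_nonpos) (auto simp: M_def)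
  finally have "(\<integral>\<omega>. ?q \<omega> \<partial>M) = 0" by (intro antisym) simp_all
  hence "AE \<omega> in M. ?q \<omega> = 0"
    using integral_nonneg_eq_0_iff_AE[OF q_int] by simp
  hence "AE \<omega> in M. Y \<omega> = M1 / M0"
    by eventually_elim (use pos in \<open>auto simp: M_def field_simps\<close>)
  thus False using \<open>nondegenerate M Y\<close> by (auto simp: nondegenerate_def)
qed

lemma expectation_pos:
  fixes h :: "'a \<Rightarrow> real"
  assumes "prob_space M" "integrable M h" "AE \<omega> in M. h \<omega> > 0"
  shows "(\<integral>\<omega>. h \<omega> \<partial>M) > 0"
proof -
  interpret prob_space M by fact
  show ?thesis
    using integral_less_AE_space[of "\<lambda>_. 0" h] assms emeasure_space_1 by simp
qed

theorem theorem3p2: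
  fixes M :: "'a measure" and X Y U V :: "'a \<Rightarrow> real" and r :: real and \<alpha> :: "real \<Rightarrow> real"
  assumes "prob_space M"
    and "prob_space.indep_var M borel X borel Y"
    and "AE \<omega> in M. X \<omega> > 0"
    and "AE \<omega> in M. Y \<omega> > 0"
    and "nondegenerate M X"
    and "nondegenerate M Y"
    and "r < 1 \<Longrightarrow> integrable M (\<lambda>\<omega>. X \<omega> powr (r - 1))"
    and "U = (\<lambda>\<omega>. (1 + 1 / (X \<omega> + Y \<omega>)) / (1 + 1 / X \<omega>))"
    and "V = (\<lambda>\<omega>. X \<omega> + Y \<omega>)"
    and "\<forall>s\<in>{r, r + 1}. AE \<omega> in M.
           cond_exp_given M (\<lambda>\<omega>. U \<omega> powr s) V \<omega>
             = \<alpha> s * cond_exp_given M (\<lambda>\<omega>. U \<omega> powr (s - 1)) V \<omega>"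
  shows "\<alpha> r \<in> {0<..<1} \<and> \<alpha> (r + 1) \<in> {0<..<1} \<and>
    \<alpha> r * (1 - \<alpha> (r + 1)) / (\<alpha> (r + 1) - \<alpha> r) > r - 1 \<and>
    (\<exists>c>0.
      distributed M lborel X
        (kummer_density
          (\<alpha> r * (1 - \<alpha> (r + 1)) / (\<alpha> (r + 1) - \<alpha> r) - r + 1)
          ((1 - \<alpha> r) * (1 - \<alpha> (r + 1)) / (\<alpha> (r + 1) - \<alpha> r)) c) \<and>
      distributed M lborel Y
        (gamma_density
          ((1 - \<alpha> r) * (1 - \<alpha> (r + 1)) / (\<alpha> (r + 1) - \<alpha> r)) c))"
proof -
  interpret prob_space M by fact
  note X = \<open>AE \<omega> in M. X \<omega> > 0\<close> and Y = \<open>AE \<omega> in M. Y \<omega> > 0\<close>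
  have [measurable]: "X \<in> borel_measurable M" "Y \<in> borel_measurable M"
    using indep_var_rv1[OF assms(2)] indep_var_rv2[OF assms(2)] by auto

  \<comment> \<open>Powers of X / (1 + X)\<close>
  define W where "W p \<omega> = (X \<omega> / (1 + X \<omega>)) powr p" for p \<omega>
  have [measurable]: "W p \<in> borel_measurable M" for p unfolding W_def by measurable
  have W_pos: "AE \<omega> in M. W p \<omega> > 0" for p
    using X by eventually_elim (simp add: W_def)
  have W_less: "AE \<omega> in M. W (p + 1) \<omega> < W p \<omega>" for p
    using X
  proof eventually_elim
    case (elim \<omega>)
    let ?w = "X \<omega> / (1 + X \<omega>)"
    have "?w powr p * ?w < ?w powr p * 1" using elim by (intro mult_strict_left_mono) auto
    thus ?case using elim by (simp add: W_def powr_add)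
  qed
  \<comment> \<open>This is W (1 + X) = X once more; under the Laplace transform it becomes the
    hypotheses \<open>rel\<close> of \<open>regression_constants\<close>.\<close>
  have W_rel: "AE \<omega> in M. W p \<omega> * X \<omega> = W (p + 1) \<omega> + W (p + 1) \<omega> * X \<omega>" for p
    using X
  proof eventually_elim
    case (elim \<omega>)
    have "W (p + 1) \<omega> = W p \<omega> * (X \<omega> / (1 + X \<omega>))" using elim by (simp add: W_def powr_add)
    moreover have "X \<omega> / (1 + X \<omega>) * (1 + X \<omega>) = X \<omega>" using elim by simp
    ultimately show ?case by algebra
  qed
  have W_int: "integrable M (W (r - 1))"
    unfolding W_def by (rule integrable_ratio_powr) (use assms in auto)
  have W_int_Suc: "integrable M (W (p + 1))" if "integrable M (W p)" for p
    using W_less[of p] W_pos[of "p + 1"]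
    by (intro Bochner_Integration.integrable_bound[OF that]) (auto elim!: eventually_elim2)
  have W_int_r: "integrable M (W r)" "integrable M (W (r + 1))"
    using W_int_Suc[OF W_int] W_int_Suc[OF W_int_Suc[OF W_int]] by simp_all

  have exp_int: "integrable M (\<lambda>\<omega>. h \<omega> * exp (- t * Z \<omega>))"
    if "integrable M h" "AE \<omega> in M. Z \<omega> > 0" "Z \<in> borel_measurable M" "t > 0" for h Z and t :: real
  proof (rule Bochner_Integration.integrable_bound[OF that(1)])
    show "AE \<omega> in M. norm (h \<omega> * exp (- t * Z \<omega>)) \<le> norm (h \<omega>)"
      using that(2) by eventually_elim (use that(4) in \<open>simp add: abs_mult mult_left_le\<close>)
    show "(\<lambda>\<omega>. h \<omega> * exp (- t * Z \<omega>)) \<in> borel_measurable M"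
      using borel_measurable_integrable[OF that(1)] that(3) by measurable
  qed
  have nonneg: "AE \<omega> in M. X \<omega> \<ge> 0" "AE \<omega> in M. Y \<omega> \<ge> 0"
    using X Y by (auto elim: eventually_mono)

  \<comment> \<open>Weighted Laplace transforms of X and Y\<close>
  define L where "L Z h t = (\<integral>\<omega>. h \<omega> * exp (- t * Z \<omega>) \<partial>M)" for Z h :: "'a \<Rightarrow> real" and t
  have L_int: "integrable M (\<lambda>\<omega>. W p \<omega> * exp (- t * X \<omega>))"
    "integrable M (\<lambda>\<omega>. W p \<omega> * X \<omega> * exp (- t * X \<omega>))"
    "integrable M (\<lambda>\<omega>. W p \<omega> * X \<omega> * X \<omega> * exp (- t * X \<omega>))"
    if p: "integrable M (W p)" and t: "t > 0" for p t
  proof -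
    have 0: "integrable M (\<lambda>\<omega>. W p \<omega> * exp (- t * X \<omega>))" if "t > 0" for t
      by (rule exp_int[OF p X _ that]) measurable
    have 1: "integrable M (\<lambda>\<omega>. W p \<omega> * X \<omega> * exp (- t * X \<omega>))" if "t > 0" for t
      by (rule laplace_integrable_mult[OF _ _ nonneg(1) 0 that]) measurable
    have "integrable M (\<lambda>\<omega>. W p \<omega> * X \<omega> * X \<omega> * exp (- t * X \<omega>))"
      by (rule laplace_integrable_mult[OF _ _ nonneg(1) 1 t]) measurable
    with 0[OF t] 1[OF t] show "integrable M (\<lambda>\<omega>. W p \<omega> * exp (- t * X \<omega>))"
      "integrable M (\<lambda>\<omega>. W p \<omega> * X \<omega> * exp (- t * X \<omega>))"
      "integrable M (\<lambda>\<omega>. W p \<omega> * X \<omega> * X \<omega> * exp (- t * X \<omega>))"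
      by blast+
  qed
  have L_deriv: "(L X (W p) has_real_derivative - L X (\<lambda>\<omega>. W p \<omega> * X \<omega>) t) (at t)"
    "(L X (\<lambda>\<omega>. W p \<omega> * X \<omega>) has_real_derivative - L X (\<lambda>\<omega>. W p \<omega> * X \<omega> * X \<omega>) t) (at t)"
    if p: "integrable M (W p)" and t: "t > 0" for p t
    unfolding L_def[abs_def]
    by (rule laplace_has_derivative[OF _ _ nonneg(1) L_int(1)[OF p] t] laplace_has_derivative[OF _ _ nonneg(1) L_int(2)[OF p] t]; measurable)+
  \<comment> \<open>The factor 1 is kept so that the first fact matches the weight in
    \<open>L Y (\<lambda>_. 1)\<close>.\<close>
  have Y_int: "integrable M (\<lambda>\<omega>. 1 * exp (- t * Y \<omega>))" "integrable M (\<lambda>\<omega>. Y \<omega> * exp (- t * Y \<omega>))"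
    "integrable M (\<lambda>\<omega>. Y \<omega> * Y \<omega> * exp (- t * Y \<omega>))" if t: "t > 0" for t
  proof -
    have 0: "integrable M (\<lambda>\<omega>. 1 * exp (- t * Y \<omega>))" if "t > 0" for t
      by (rule exp_int[OF _ Y _ that]) auto
    have 1: "integrable M (\<lambda>\<omega>. Y \<omega> * exp (- t * Y \<omega>))" if "t > 0" for t
      using laplace_integrable_mult[OF _ _ nonneg(2) 0 that] by simp
    have "integrable M (\<lambda>\<omega>. Y \<omega> * Y \<omega> * exp (- t * Y \<omega>))"
      by (rule laplace_integrable_mult[OF _ _ nonneg(2) 1 t]) measurable
    with 0[OF t] 1[OF t] show "integrable M (\<lambda>\<omega>. 1 * exp (- t * Y \<omega>))"
      "integrable M (\<lambda>\<omega>. Y \<omega> * exp (- t * Y \<omega>))"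
      "integrable M (\<lambda>\<omega>. Y \<omega> * Y \<omega> * exp (- t * Y \<omega>))"
      by blast+
  qed
  have Y_deriv: "(L Y (\<lambda>_. 1) has_real_derivative - L Y Y t) (at t)"
    "(L Y Y has_real_derivative - L Y (\<lambda>\<omega>. Y \<omega> * Y \<omega>) t) (at t)" if t: "t > 0" for t
    using laplace_has_derivative[OF _ _ nonneg(2) Y_int(1) t] laplace_has_derivative[OF _ _ nonneg(2) Y_int(2) t]
    by (simp_all add: L_def[abs_def])
  have L_pos: "L X (W p) t > 0" "L X (\<lambda>\<omega>. W p \<omega> * X \<omega>) t > 0" "L X (W (p + 1)) t < L X (W p) t"
    if "integrable M (W p)" "t > 0" for p t
  proof -
    have "AE \<omega> in M. W p \<omega> * exp (- t * X \<omega>) > 0"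
      using W_pos[of p] by eventually_elim simp
    from expectation_pos[OF assms(1) L_int(1)[OF that] this] show "L X (W p) t > 0"
      by (simp only: L_def)
    have "AE \<omega> in M. W p \<omega> * X \<omega> * exp (- t * X \<omega>) > 0"
      using W_pos[of p] X by eventually_elim simp
    from expectation_pos[OF assms(1) L_int(2)[OF that] this] show "L X (\<lambda>\<omega>. W p \<omega> * X \<omega>) t > 0"
      by (simp only: L_def)
    have "AE \<omega> in M. W (p + 1) \<omega> * exp (- t * X \<omega>) < W p \<omega> * exp (- t * X \<omega>)"
      using W_less[of p] by eventually_elim simp
    from integral_less_AE_space[OF L_int(1)[OF W_int_Suc[OF that(1)] that(2)] L_int(1)[OF that] this]
    show "L X (W (p + 1)) t < L X (W p) t"
      by (simp only: L_def emeasure_space_1 one_neq_zero not_False_eq_True)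
  qed
  have Y_pos: "L Y (\<lambda>_. 1) t > 0" "L Y Y t > 0" if t: "t > 0" for t
  proof -
    have "AE \<omega> in M. 1 * exp (- t * Y \<omega>) > 0" by simp
    from expectation_pos[OF assms(1) Y_int(1)[OF t] this] show "L Y (\<lambda>_. 1) t > 0"
      by (simp only: L_def)
    have "AE \<omega> in M. Y \<omega> * exp (- t * Y \<omega>) > 0"
      using Y by eventually_elim simp
    from expectation_pos[OF assms(1) Y_int(2)[OF t] this] show "L Y Y t > 0"
      by (simp only: L_def)
  qed
  have L_rel: "L X (\<lambda>\<omega>. W p \<omega> * X \<omega>) t = L X (W (p + 1)) t + L X (\<lambda>\<omega>. W (p + 1) \<omega> * X \<omega>) t"
    "L X (\<lambda>\<omega>. W p \<omega> * X \<omega> * X \<omega>) t = L X (\<lambda>\<omega>. W (p + 1) \<omega> * X \<omega>) t + L X (\<lambda>\<omega>. W (p + 1) \<omega> * X \<omega> * X \<omega>) t"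
    if "integrable M (W p)" "t > 0" for p t
  proof -
    note int = L_int[OF W_int_Suc[OF that(1)] that(2)]
    have "L X (\<lambda>\<omega>. W p \<omega> * X \<omega>) t = (\<integral>\<omega>. W (p + 1) \<omega> * exp (- t * X \<omega>) + W (p + 1) \<omega> * X \<omega> * exp (- t * X \<omega>) \<partial>M)"
      unfolding L_def using W_rel[of p] by (intro integral_cong_AE) (auto elim!: eventually_mono simp: distrib_right)
    thus "L X (\<lambda>\<omega>. W p \<omega> * X \<omega>) t = L X (W (p + 1)) t + L X (\<lambda>\<omega>. W (p + 1) \<omega> * X \<omega>) t"
      using int unfolding L_def by (simp only: Bochner_Integration.integral_add)
    have "L X (\<lambda>\<omega>. W p \<omega> * X \<omega> * X \<omega>) t
        = (\<integral>\<omega>. W (p + 1) \<omega> * X \<omega> * exp (- t * X \<omega>) + W (p + 1) \<omega> * X \<omega> * X \<omega> * exp (- t * X \<omega>) \<partial>M)"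
      unfolding L_def using W_rel[of p] by (intro integral_cong_AE) (auto elim!: eventually_mono simp: distrib_right)
    thus "L X (\<lambda>\<omega>. W p \<omega> * X \<omega> * X \<omega>) t = L X (\<lambda>\<omega>. W (p + 1) \<omega> * X \<omega>) t + L X (\<lambda>\<omega>. W (p + 1) \<omega> * X \<omega> * X \<omega>) t"
      using int unfolding L_def by (simp only: Bochner_Integration.integral_add)
  qed
  have reg: "L X (\<lambda>\<omega>. W (s - 1) \<omega> * X \<omega>) t * L Y (\<lambda>_. 1) t + L X (W s) t * L Y Y t
      = \<alpha> s * (L X (\<lambda>\<omega>. W (s - 1) \<omega> * X \<omega>) t * L Y (\<lambda>_. 1) t + L X (W (s - 1)) t * L Y Y t)"
    if "integrable M (W (s - 1))" "s \<in> {r, r + 1}" "t > 0" for s t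
  proof -
    have "AE \<omega> in M. cond_exp_given M (\<lambda>\<omega>. U \<omega> powr s) V \<omega>
            = \<alpha> s * cond_exp_given M (\<lambda>\<omega>. U \<omega> powr (s - 1)) V \<omega>"
      using assms(10) that(2) by blast
    from regression_laplace_equation[OF assms(1,2) X Y that(1)[unfolded W_def[abs_def]]
        this[unfolded assms(8,9)] that(3)]
    show ?thesis by (simp add: L_def W_def)
  qed
  have CS: "L Y Y t * L Y Y t < L Y (\<lambda>_. 1) t * L Y (\<lambda>\<omega>. Y \<omega> * Y \<omega>) t" if "t > 0" for t
    using laplace_second_moment_strict[of M Y t] Y_int[OF that] Y_pos[OF that] assms(1,6)
    by (simp add: L_def)

  \<comment> \<open>Identification of the two laws\<close>
  let ?a = "\<alpha> r" and ?b = "\<alpha> (r + 1)"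
  note rc = regression_constants[where \<alpha> = "?a" and \<beta> = "?b"
      and f = "L X (W (r - 1))" and fd = "L X (\<lambda>\<omega>. W (r - 1) \<omega> * X \<omega>)" and fdd = "L X (\<lambda>\<omega>. W (r - 1) \<omega> * X \<omega> * X \<omega>)"
      and g = "L X (W r)" and gd = "L X (\<lambda>\<omega>. W r \<omega> * X \<omega>)" and gdd = "L X (\<lambda>\<omega>. W r \<omega> * X \<omega> * X \<omega>)"
      and k = "L X (W (r + 1))" and kd = "L X (\<lambda>\<omega>. W (r + 1) \<omega> * X \<omega>)"
      and m = "L Y (\<lambda>_. 1)" and md = "L Y Y" and mdd = "L Y (\<lambda>\<omega>. Y \<omega> * Y \<omega>)"]
  note W_r = L_pos(3)[OF W_int] L_rel[OF W_int] reg[OF W_int]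
  \<comment> \<open>Simplification turns the exponents r - 1 + 1 into r, so that these facts fit the
    chosen instances.\<close>
  note W_r' = W_r[simplified]
  note reg' = reg[of "r + 1", simplified]
  note regr = rc[OF L_pos(1)[OF W_int_r(1)] W_r'(1) L_pos(1)[OF W_int_r(2)] L_pos(3)[OF W_int_r(1)]
        L_pos(2)[OF W_int] L_pos(2)[OF W_int_r(1)] Y_pos CS
        L_deriv[OF W_int] L_deriv[OF W_int_r(1)] L_deriv(1)[OF W_int_r(2)] Y_deriv
        W_r'(2) L_rel(1)[OF W_int_r(1)] W_r'(3) W_r'(4) reg'[OF W_int_r(1)]]
  \<comment> \<open>With p = r - 1 the Kummer parameters are \<theta> - p and \<open>b\<close>.
    Their sum, the exponent of 1 + x, is \<kappa> - p, because \<kappa> = \<theta> + b.\<close>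
  define b where "b = (1 - ?a) * (1 - ?b) / (?b - ?a)"
  define \<kappa> where "\<kappa> = (1 - ?b) / (?b - ?a)"
  define \<theta> where "\<theta> = ?a * (1 - ?b) / (?b - ?a)"
  have \<theta>: "\<theta> = \<kappa> * ?a" by (simp add: \<theta>_def \<kappa>_def)
  have \<kappa>: "\<kappa> = \<theta> + b"
  proof -
    have "?a * (1 - ?b) + (1 - ?a) * (1 - ?b) = 1 - ?b" by algebra
    thus ?thesis by (simp add: \<kappa>_def \<theta>_def b_def flip: add_divide_distrib)
  qed
  obtain c where c: "c \<ge> 0"
    and cY: "\<And>t. t > 0 \<Longrightarrow> (t + c) * L Y Y t = b * L Y (\<lambda>_. 1) t"
    and cX: "\<And>t. t > 0 \<Longrightarrow> (t + c) * L X (\<lambda>\<omega>. W (r - 1) \<omega> * X \<omega>) t = \<kappa> * (?a * L X (W (r - 1)) t - L X (W r) t)"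
    using regr(6) unfolding b_def \<kappa>_def by blast
  have X_eq: "(t + c) * (\<integral>\<omega>. (X \<omega> / (1 + X \<omega>)) powr (r - 1) * X \<omega> * exp (- t * X \<omega>) \<partial>M)
      = \<theta> * (\<integral>\<omega>. (X \<omega> / (1 + X \<omega>)) powr (r - 1) * exp (- t * X \<omega>) \<partial>M)
        - \<kappa> * (\<integral>\<omega>. (X \<omega> / (1 + X \<omega>)) powr (r - 1 + 1) * exp (- t * X \<omega>) \<partial>M)" if "t > 0" for t
    using cX[OF that] by (simp add: L_def W_def \<theta> right_diff_distrib mult.assoc)
  \<comment> \<open>The gamma case uses the weight exponent 0. Since \<open>0 powr 0\<close> is 0,
    the weight equals 1 only where Y / (1 + Y) is nonzero, hence almost surely.\<close>
  have Y_0: "AE \<omega> in M. (Y \<omega> / (1 + Y \<omega>)) powr 0 = 1"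
    using Y by eventually_elim simp
  have Y_eq: "(t + c) * (\<integral>\<omega>. (Y \<omega> / (1 + Y \<omega>)) powr 0 * Y \<omega> * exp (- t * Y \<omega>) \<partial>M)
      = b * (\<integral>\<omega>. (Y \<omega> / (1 + Y \<omega>)) powr 0 * exp (- t * Y \<omega>) \<partial>M)
        - 0 * (\<integral>\<omega>. (Y \<omega> / (1 + Y \<omega>)) powr (0 + 1) * exp (- t * Y \<omega>) \<partial>M)" if "t > 0" for t
  proof -
    have "(\<integral>\<omega>. (Y \<omega> / (1 + Y \<omega>)) powr 0 * Y \<omega> * exp (- t * Y \<omega>) \<partial>M) = L Y Y t"
      unfolding L_def using Y_0 by (intro integral_cong_AE) (auto elim!: eventually_mono)
    moreover have "(\<integral>\<omega>. (Y \<omega> / (1 + Y \<omega>)) powr 0 * exp (- t * Y \<omega>) \<partial>M) = L Y (\<lambda>_. 1) t"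
      unfolding L_def using Y_0 by (intro integral_cong_AE) (auto elim!: eventually_mono)
    ultimately show ?thesis using cY[OF that] by simp
  qed
  have Y_W_int: "integrable M (\<lambda>\<omega>. (Y \<omega> / (1 + Y \<omega>)) powr 0)"
    by (rule integrable_ratio_powr[OF assms(1) _ Y]) auto
  note X_dist = kummer_type_distributed[OF assms(1) _ X c W_int[unfolded W_def[abs_def]] X_eq]
    and Y_dist = kummer_type_distributed[OF assms(1) _ Y c Y_W_int Y_eq]
  have kummer: "kummer_density (\<theta> - r + 1) b c
      = normalized_density (\<lambda>x. x powr (\<theta> - (r - 1) - 1) * exp (- c * x) / (1 + x) powr (\<kappa> - (r - 1)) * indicator {0<..} x)"
    unfolding kummer_density_def \<kappa> by (simp add: algebra_simps)
  have gamma: "gamma_density b c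
      = normalized_density (\<lambda>x. x powr (b - 0 - 1) * exp (- c * x) / (1 + x) powr (0 - 0) * indicator {0<..} x)"
    unfolding gamma_density_def by (intro arg_cong[where f = normalized_density]) (auto simp: indicator_def)
  have "distributed M lborel X (kummer_density (\<theta> - r + 1) b c)"
    unfolding kummer by (rule X_dist(1)) measurable
  moreover have "distributed M lborel Y (gamma_density b c)"
    unfolding gamma by (rule Y_dist(1)) measurable
  \<comment> \<open>The gamma law of Y decides the sign of c: without exponential decay its power
    density would not be integrable at infinity.\<close>
  moreover have "c > 0" by (rule Y_dist(3)) auto
  moreover have "\<theta> > r - 1" using X_dist(2) by simp
  ultimately show ?thesis
    using regr(1-4) unfolding b_def \<theta>_def by auto
qed

end
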